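(* The following eight evaluations hold: \[\sum_{n=1}^\infty \frac{H_n\bar H_n^{(2)}}{n^2}(-1)^{n-1}=\frac{125}{32}\zeta(5)-\frac{13}{8}\zeta(2)\zeta(3),\] \[\sum_{n=1}^\infty \frac{H_n^{(2)}\bar H_n^{(2)}}{n}(-1)^{n-1}=\frac{75}{64}\zeta(5)+\frac38\zeta(2)\zeta(3)-\frac{25}{16}\zeta(4)\ln 2,\] \[\sum_{n=1}^\infty \frac{H_n\bar H_n^{(2)}}{n^2}=4\,\mathrm{Li}_5\left(\tfrac12\right)+4\,\mathrm{Li}_4\left(\tfrac12\right)\ln 2+\frac{2}{15}\ln^5 2+\frac{29}{64}\zeta(5)+\frac74\zeta(3)\ln^2 2-\frac23\zeta(2)\ln^3 2-\frac54\zeta(2)\zeta(3),\] \[\sum_{n=1}^\infty \frac{H_n^2H_n^{(2)}}{n}(-1)^{n-1}=-2\,\mathrm{Li}_4\left(\tfrac12\right)\ln 2-\frac1{12}\ln^5 2-\frac78\zeta(3)\ln^2 2+\frac13\zeta(2)\ln^3 2+\frac38\zeta(2)\zeta(3)+\frac78\zeta(4)\ln 2,\] \[\sum_{n=1}^\infty \frac{H_n^{(2)}\bar H_n}{n^2}=-8\,\mathrm{Li}_5\left(\tfrac12\right)-4\,\mathrm{Li}_4\left(\tfrac12\right)\ln 2-\frac1{10}\ln^5 2+\frac{27}{4}\zeta(5)+\frac13\zeta(2)\ln^3 2+\frac12\zeta(2)\zeta(3)-\frac{23}{16}\zeta(4)\ln 2,\] \[\sum_{n=1}^\infty \frac{(H_n^{(2)})^2}{n}(-1)^{n-1}=16\,\mathrm{Li}_5\left(\tfrac12\right)+8\,\mathrm{Li}_4\left(\tfrac12\right)\ln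 2+\frac15\ln^5 2-\frac{259}{16}\zeta(5)-\frac23\zeta(2)\ln^3 2+\frac58\zeta(2)\zeta(3)+\frac{29}{4}\zeta(4)\ln 2,\] \[\sum_{n=1}^\infty \frac{(\bar H_n^{(2)})^2}{n}(-1)^{n-1}=-16\,\mathrm{Li}_5\left(\tfrac12\right)-8\,\mathrm{Li}_4\left(\tfrac12\right)\ln 2-\frac15\ln^5 2+\frac{299}{16}\zeta(5)+\frac23\zeta(2)\ln^3 2-\frac14\zeta(2)\zeta(3)-\frac{39}{4}\zeta(4)\ln 2,\] \[\sum_{n=1}^\infty \frac{H_n^4}{n}(-1)^{n-1}=8\,\mathrm{Li}_5\left(\tfrac12\right)+4\,\mathrm{Li}_4\left(\tfrac12\right)\ln 2+\frac3{10}\ln^5 2+\frac94\zeta(3)\ln^2 2-\frac{83}{16}\zeta(5)-\frac43\zeta(2)\ln^3 2-\frac{11}{8}\zeta(2)\zeta(3)+\frac{11}{4}\zeta(4)\ln 2.\]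
   Context: For positive integers $n,p$: $H_n^{(p)}=\sum_{j=1}^n j^{-p}$, $H_n=H_n^{(1)}$; $\bar H_n^{(p)}=\sum_{j=1}^n (-1)^{j-1}j^{-p}$, $\bar H_n=\bar H_n^{(1)}$. $\zeta$ is the Riemann zeta function and $\mathrm{Li}_p(x)=\sum_{n\ge1}x^n/n^p$. The infinite sums are limits of partial sums (they may converge only conditionally). *)

theory Defs
  imports "HOL-Analysis.Analysis"
begin

definition gen_harm :: "nat \<Rightarrow> nat \<Rightarrow> real" where
  "gen_harm p n = (\<Sum>j=1..n. 1 / real j ^ p)"

definition alt_harm :: "nat \<Rightarrow> nat \<Rightarrow> real" where
  "alt_harm p n = (\<Sum>j=1..n. (-1) ^ (j - 1) / real j ^ p)"

lemma gen_harm_1: "gen_harm 1 n = harm n"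
  by (simp add: gen_harm_def harm_def inverse_eq_divide)

(* Riemann zeta function at integers p >= 2, where its Dirichlet series converges;
   for p < 2 the value is meaningless. *)
definition zeta :: "nat \<Rightarrow> real" where
  "zeta p = (\<Sum>n. 1 / real (Suc n) ^ p)"

(* Meaningful where the series converges, in particular for \<bar>x\<bar> < 1. *)
definition polylog :: "nat \<Rightarrow> real \<Rightarrow> real" where
  "polylog p x = (\<Sum>n. x ^ Suc n / real (Suc n) ^ p)"

end

theory Submission
  imports Defs
begin

text \<open>
  Expanding the products of harmonic numbers by the quasi-shuffle (stuffle) product turns every
  sum into a linear combination of alternating multiple zeta values of weight five. These are the
  values at 1 of iterated integrals of the forms \<open>dt/t\<close>, \<open>dt/(1 - t)\<close>, \<open>dt/(1 + t)\<close>, and satisfy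
  linear relations: the product of two of them can be expanded both by shuffling the integrals and
  by stuffling the sums, also when one factor is the divergent harmonic series; the substitution
  \<open>t \<mapsto> t\<^sup>2\<close> gives the doubling relations; and \<open>t \<mapsto> t/(1 + t)\<close> expresses \<open>polylog k (1/2)\<close>.
  Solving these relations weight by weight reduces the required values to products of
  \<open>ln 2\<close>, \<open>zeta k\<close> and \<open>polylog k (1/2)\<close>.
\<close>

subsection \<open>Iterated integrals\<close>

text \<open>Many of the series involved converge only conditionally, so they cannot be multiplied or
  rearranged at the point 1. Shuffle products and substitutions are therefore proved for power
  series on [0,1), where comparing derivatives suffices, and carried to 1 by Abel's theorem. Stuffle
  products are identities between finite sums, for which an ordinary limit is enough. The obstacle
  is the product with the divergent word \<open>[P]\<close>: there a convergence error gets
  multiplied by a logarithm, and a purely qualitative limit theorem says nothing about the result.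
  This is why \<open>cf_convergence\<close> also supplies the rate N^(-1/2), which is transferred to
  x near 1 by \<open>G_rate\<close>. The minus sign in the third form makes \<open>M\<close> act on
  coefficients like \<open>P\<close>, conjugated by (-1)^n. Words and nested sums then correspond
  without any correction of signs. In weight five the linear system is not solved completely. Some
  words stay undetermined, and the eight sums are combinations from which these words drop
  out.\<close>

text \<open>
  The letters stand for the differential forms \<open>dt/t\<close>, \<open>dt/(1 - t)\<close>, \<open>- dt/(1 + t)\<close>; the
  constants \<open>cf w n\<close> are the Taylor coefficients at 0 of the iterated integral of the word
  \<open>w\<close> with innermost form last. At \<open>n = 0\<close> the division by zero yields the correct value 0,
  except that the divergent words ending in \<open>A\<close> get junk values.
\<close>

datatype letter = A | P | M

fun cf :: "letter list \<Rightarrow> nat \<Rightarrow> real" where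
  "cf [] n = (if n = 0 then 1 else 0)"
| "cf (A # w) n = cf w n / n"
| "cf (P # w) n = (\<Sum>m<n. cf w m) / n"
| "cf (M # w) n = (-1) ^ n * (\<Sum>m<n. (-1) ^ m * cf w m) / n"

definition G :: "letter list \<Rightarrow> real \<Rightarrow> real" where
  "G w x = (\<Sum>n. cf w n * x ^ n)"

definition Z :: "letter list \<Rightarrow> real" where
  "Z w = (\<Sum>n. cf w n)"

fun form :: "letter \<Rightarrow> real \<Rightarrow> real" where
  "form A t = 1 / t"
| "form P t = 1 / (1 - t)"
| "form M t = - 1 / (1 + t)"

lemma cf_0 [simp]: "w \<noteq> [] \<Longrightarrow> cf w 0 = 0"
  by (cases "(w, 0::nat)" rule: cf.cases) auto

text \<open>A new letter divides a sum of at most n terms by n, so the bound 1 is inherited. It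
  gives every \<open>G w\<close> a radius of convergence of at least 1.\<close>

lemma abs_cf_le_1: "\<bar>cf w n\<bar> \<le> 1"
proof (induction w n rule: cf.induct)
  case (2 w n)
  then show ?case by (cases "n = 0") (auto simp: field_simps)
next
  case (3 w n)
  have "\<bar>\<Sum>m<n. cf w m\<bar> \<le> (\<Sum>m<n. 1)"
    by (rule order.trans[OF sum_abs sum_mono]) (use 3 in auto)
  then show ?case by (cases "n = 0") (auto simp: field_simps)
next
  case (4 w n)
  have "\<bar>\<Sum>m<n. (-1) ^ m * cf w m\<bar> \<le> (\<Sum>m<n. 1)"
    by (rule order.trans[OF sum_abs sum_mono]) (use 4 in \<open>auto simp: abs_mult power_abs\<close>)
  then show ?case by (cases "n = 0") (auto simp: field_simps abs_mult power_abs)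
qed auto

lemma summable_bounded_power_series:
  fixes c :: "nat \<Rightarrow> real"
  assumes "\<And>n. \<bar>c n\<bar> \<le> B" "\<bar>x\<bar> < 1"
  shows "summable (\<lambda>n. c n * x ^ n)"
proof (rule summable_comparison_test)
  show "\<exists>N. \<forall>n\<ge>N. norm (c n * x ^ n) \<le> B * \<bar>x\<bar> ^ n"
    using assms by (auto simp: abs_mult power_abs intro!: mult_right_mono)
  show "summable (\<lambda>n. B * \<bar>x\<bar> ^ n)"
    using assms(2) by (intro summable_mult summable_geometric) auto
qed

lemma summable_G: "\<bar>x\<bar> < 1 \<Longrightarrow> summable (\<lambda>n. cf w n * x ^ n)"
  by (rule summable_bounded_power_series[OF abs_cf_le_1])

lemma G_Nil [simp]: "G [] x = 1"
proof -
  have "(\<lambda>n. cf [] n * x ^ n) sums 1"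
    using sums_single[of 0 "\<lambda>n. 1"] by (rule sums_cong[THEN iffD1, rotated]) auto
  then show ?thesis by (simp add: G_def sums_iff)
qed

lemma G_0 [simp]: "w \<noteq> [] \<Longrightarrow> G w 0 = 0"
  by (simp add: G_def)

text \<open>Multiplication by \<open>1 - x\<close> telescopes partial sums back to their terms. This
  one identity serves the letters \<open>P\<close> and \<open>M\<close>, Abel's theorem and the rate
  estimate near 1.\<close>

lemma power_series_partial_sums:
  fixes a :: "nat \<Rightarrow> real"
  assumes "summable (\<lambda>n. (\<Sum>m<Suc n. a m) * x ^ n)"
  shows "(1 - x) * (\<Sum>n. (\<Sum>m<Suc n. a m) * x ^ n) = (\<Sum>n. a n * x ^ n)"
proof -
  define s where "s n = (\<Sum>m<Suc n. a m)" for n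
  have s: "(\<lambda>n. s n * x ^ n) sums (\<Sum>n. s n * x ^ n)"
    using assms by (simp add: s_def summable_sums)
  have "(\<lambda>n. s (Suc n) * x ^ Suc n - x * (s n * x ^ n)) sums
      ((\<Sum>n. s n * x ^ n) - s 0 - x * (\<Sum>n. s n * x ^ n))"
    by (intro sums_diff sums_mult s) (use sums_Suc_iff[of "\<lambda>n. s n * x ^ n"] s in simp)
  then have "(\<lambda>n. a (Suc n) * x ^ Suc n) sums ((1 - x) * (\<Sum>n. s n * x ^ n) - a 0)"
    by (simp add: s_def algebra_simps)
  then have "(\<lambda>n. a n * x ^ n) sums ((1 - x) * (\<Sum>n. s n * x ^ n))"
    using sums_Suc_iff[of "\<lambda>n. a n * x ^ n"] by simp
  then show ?thesis
    by (simp add: sums_iff s_def)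
qed

lemma G_has_deriv:
  assumes "\<bar>x\<bar> < 1"
  shows "(G w has_real_derivative (\<Sum>n. diffs (cf w) n * x ^ n)) (at x)"
    and "summable (\<lambda>n. diffs (cf w) n * x ^ n)"
proof -
  obtain r where r: "\<bar>x\<bar> < r" "r < 1" using assms dense by blast
  have "\<bar>r\<bar> < 1" using r by auto
  from summable_G[OF this] have "summable (\<lambda>n. cf w n * r ^ n)" .
  from termdiffs_strong[OF this] r
  show "(G w has_real_derivative (\<Sum>n. diffs (cf w) n * x ^ n)) (at x)"
    by (simp add: G_def [abs_def])
  show "summable (\<lambda>n. diffs (cf w) n * x ^ n)"
    by (rule termdiff_converges[of _ 1]) (use assms summable_G in auto)
qed

lemma isCont_G: "\<bar>x\<bar> < 1 \<Longrightarrow> isCont (G w) x"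
  using G_has_deriv(1) DERIV_isCont by blast

text \<open>Differentiation turns the coefficients of \<open>a # w\<close> into those of
  \<open>w\<close>, shifted for \<open>A\<close>, summed up for \<open>P\<close>, and summed up with
  alternating signs for \<open>M\<close>, which is the case \<open>P\<close> at \<open>- x\<close>.
  The word \<open>[A]\<close> is excluded because all its coefficients are 0, while the formula
  would demand the derivative 1/x.\<close>

lemma G_deriv:
  assumes "0 < x" "x < 1" "a # w \<noteq> [A]"
  shows "(G (a # w) has_real_derivative form a x * G w x) (at x)"
proof -
  have x: "\<bar>x\<bar> < 1" "\<bar>- x\<bar> < 1" using assms by auto
  have *: "(\<Sum>n. diffs (cf (a # w)) n * x ^ n) = form a x * G w x"
  proof (cases a)
    case A
    then have w: "w \<noteq> []" using assms by auto
    have "(\<lambda>n. cf w (Suc n) * x ^ Suc n) sums G w x"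
      using summable_sums[OF summable_G[OF x(1), of w]] w sums_Suc_iff[of "\<lambda>n. cf w n * x ^ n"]
      by (simp add: G_def)
    from sums_mult[OF this, of "1 / x"]
    have "(\<lambda>n. cf w (Suc n) * x ^ n) sums (G w x / x)" using assms by (simp add: field_simps)
    then show ?thesis using A by (simp add: sums_iff diffs_def)
  next
    case P
    have "diffs (cf (a # w)) = (\<lambda>n. \<Sum>m<Suc n. cf w m)"
      using P by (auto simp: diffs_def fun_eq_iff)
    with G_has_deriv(2)[OF x(1), of "a # w"] power_series_partial_sums[of "cf w" x]
    have "(1 - x) * (\<Sum>n. diffs (cf (a # w)) n * x ^ n) = G w x" by (simp add: G_def)
    then show ?thesis using assms P by (simp add: field_simps)
  next
    case M
    have eq: "diffs (cf (a # w)) n * x ^ n = - ((\<Sum>m<Suc n. (-1) ^ m * cf w m) * (-x) ^ n)" for n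
    proof -
      have "(- x) ^ n = (-1) ^ n * x ^ n" by (metis mult_minus1 power_mult_distrib)
      then show ?thesis using M by (simp add: diffs_def del: sum.lessThan_Suc)
    qed
    have sm: "summable (\<lambda>n. (\<Sum>m<Suc n. (-1) ^ m * cf w m) * (-x) ^ n)"
      using G_has_deriv(2)[OF x(1), of "a # w"] unfolding eq summable_minus_iff .
    have "(-1) ^ n * cf w n * (-x) ^ n = cf w n * x ^ n" for n
      using power_mult_distrib[of "-1" "-x" n]
      by (simp add: mult.commute mult.left_commute)
    then have "(1 - (- x)) * (\<Sum>n. (\<Sum>m<Suc n. (-1) ^ m * cf w m) * (-x) ^ n) = G w x"
      using power_series_partial_sums[OF sm] unfolding G_def by presburger
    moreover have "(\<Sum>n. diffs (cf (a # w)) n * x ^ n) =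
        - (\<Sum>n. (\<Sum>m<Suc n. (-1) ^ m * cf w m) * (-x) ^ n)"
      unfolding eq using sm by (rule suminf_minus)
    ultimately show ?thesis using assms M by (simp add: field_simps)
  qed
  show ?thesis using G_has_deriv(1)[OF x(1), of "a # w"] unfolding * .
qed

subsection \<open>Abel's limit theorem\<close>

text \<open>Split at the index where the terms drop below e/2. The tail is at most (e/2)/(1 - x),
  which the factor 1 - x compensates; the same factor annihilates the bounded head as x tends to
  1.\<close>

lemma Abel_null:
  fixes d :: "nat \<Rightarrow> real"
  assumes "d \<longlonglongrightarrow> 0"
  shows "((\<lambda>x. (1 - x) * (\<Sum>n. d n * x ^ n)) \<longlongrightarrow> 0) (at_left 1)"
proof (rule tendstoI)
  fix e :: real assume e: "e > 0"
  obtain B where B: "\<And>n. \<bar>d n\<bar> \<le> B"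
    using convergent_imp_Bseq[of d] assms by (auto simp: convergent_def Bseq_def)
  obtain N where N: "\<And>n. n \<ge> N \<Longrightarrow> \<bar>d n\<bar> < e / 2"
    using LIMSEQ_D[OF assms, of "e/2"] e by auto
  have bound: "\<bar>(1 - x) * (\<Sum>n. d n * x ^ n)\<bar> \<le> (1 - x) * (real N * B) + e / 2" if x: "0 < x" "x < 1" for x
  proof -
    have sd: "summable (\<lambda>n. \<bar>d n\<bar> * x ^ n)"
      using x B by (intro summable_bounded_power_series[of _ B]) auto
    have B0: "B \<ge> 0" using B[of 0] by auto
    have "\<bar>\<Sum>n. d n * x ^ n\<bar> \<le> (\<Sum>n. \<bar>d n\<bar> * x ^ n)"
      using summable_rabs[of "\<lambda>n. d n * x ^ n"] sd x by (simp add: abs_mult)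
    also have "\<dots> = (\<Sum>n. \<bar>d (n + N)\<bar> * x ^ (n + N)) + (\<Sum>n<N. \<bar>d n\<bar> * x ^ n)"
      by (rule suminf_split_initial_segment[OF sd])
    also have "(\<Sum>n<N. \<bar>d n\<bar> * x ^ n) \<le> (\<Sum>n<N. B * 1)"
      using B B0 x by (intro sum_mono mult_mono power_le_one) auto
    also have "(\<Sum>n. \<bar>d (n + N)\<bar> * x ^ (n + N)) \<le> (\<Sum>n. e / 2 * x ^ n)"
    proof (rule suminf_le)
      show "\<bar>d (n + N)\<bar> * x ^ (n + N) \<le> e / 2 * x ^ n" for n
        using N[of "n + N"] x e by (intro mult_mono power_decreasing) auto
      show "summable (\<lambda>n. \<bar>d (n + N)\<bar> * x ^ (n + N))"
        using sd by (rule summable_ignore_initial_segment)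
      show "summable (\<lambda>n. e / 2 * x ^ n)"
        using x by (intro summable_mult summable_geometric) auto
    qed
    also have "(\<Sum>n. e / 2 * x ^ n) = e / 2 / (1 - x)"
      using x by (subst suminf_mult) (auto simp: suminf_geometric summable_geometric)
    finally have "(1 - x) * \<bar>\<Sum>n. d n * x ^ n\<bar> \<le> (1 - x) * (e / 2 / (1 - x) + real N * B)"
      using x by (intro mult_left_mono) auto
    also have "(1 - x) * (e / 2 / (1 - x) + real N * B) = (1 - x) * (real N * B) + e / 2"
      using x by (simp add: field_simps)
    finally show ?thesis using x by (simp add: abs_mult)
  qed
  have "((\<lambda>x. (1 - x) * (real N * B) + e / 2) \<longlongrightarrow> (1 - 1) * (real N * B) + e / 2) (at_left 1)"
    by (intro tendsto_intros)
  then have "\<forall>\<^sub>F x in at_left 1. (1 - x) * (real N * B) + e / 2 < e"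
    by (rule order_tendstoD(2)) (use e in auto)
  moreover have "\<forall>\<^sub>F x::real in at_left 1. 0 < x \<and> x < 1"
    using eventually_at_left_real[of 0 1] by (auto elim: eventually_mono)
  ultimately show "\<forall>\<^sub>F x in at_left 1. dist ((1 - x) * (\<Sum>n. d n * x ^ n)) 0 < e"
    by eventually_elim (use bound in \<open>auto simp: dist_real_def intro: le_less_trans\<close>)
qed

text \<open>The power series minus the limit is \<open>1 - x\<close> times the power series with
  coefficients \<open>s n - suminf a\<close>, to which \<open>Abel_null\<close> applies.\<close>

lemma Abel_limit:
  fixes a :: "nat \<Rightarrow> real"
  assumes "summable a"
  shows "((\<lambda>x. \<Sum>n. a n * x ^ n) \<longlongrightarrow> suminf a) (at_left 1)"
proof -
  define s where "s n = (\<Sum>m<Suc n. a m)" for n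
  have s: "s \<longlonglongrightarrow> suminf a"
    using LIMSEQ_Suc[OF summable_LIMSEQ[OF assms]] by (simp add: s_def [abs_def] del: sum.lessThan_Suc)
  then obtain B where B: "\<And>n. \<bar>s n\<bar> \<le> B"
    using convergent_imp_Bseq[of s] by (auto simp: convergent_def Bseq_def)
  have "((\<lambda>x. (1 - x) * (\<Sum>n. (s n - suminf a) * x ^ n)) \<longlongrightarrow> 0) (at_left 1)"
    using s by (intro Abel_null) (simp add: LIM_zero)
  then have "((\<lambda>x. (1 - x) * (\<Sum>n. (s n - suminf a) * x ^ n) + suminf a) \<longlongrightarrow> 0 + suminf a) (at_left 1)"
    by (intro tendsto_intros)
  moreover have "\<forall>\<^sub>F x in at_left 1. (1 - x) * (\<Sum>n. (s n - suminf a) * x ^ n) + suminf a = (\<Sum>n. a n * x ^ n)"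
    using eventually_at_left_real[of "0::real" 1, OF zero_less_one]
  proof eventually_elim
    case (elim x)
    then have x: "\<bar>x\<bar> < 1" "x < 1" by auto
    have sm: "summable (\<lambda>n. s n * x ^ n)"
      by (rule summable_bounded_power_series[OF B x(1)])
    have "(\<Sum>n. (s n - suminf a) * x ^ n) = (\<Sum>n. s n * x ^ n - suminf a * x ^ n)"
      by (simp add: algebra_simps)
    also have "\<dots> = (\<Sum>n. s n * x ^ n) - suminf a * (1 / (1 - x))"
      using x sm by (subst suminf_diff[symmetric])
        (auto simp: suminf_mult suminf_geometric summable_geometric intro!: summable_mult)
    finally have "(1 - x) * (\<Sum>n. (s n - suminf a) * x ^ n) = (1 - x) * (\<Sum>n. s n * x ^ n) - suminf a"
      using x by (simp add: field_simps)
    also have "(1 - x) * (\<Sum>n. s n * x ^ n) = (\<Sum>n. a n * x ^ n)"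
      using power_series_partial_sums[of a x] sm by (simp add: s_def)
    finally show ?case by simp
  qed
  ultimately show ?thesis by (simp add: tendsto_cong)
qed

lemma G_tendsto_Z: "summable (cf w) \<Longrightarrow> (G w \<longlongrightarrow> Z w) (at_left 1)"
  using Abel_limit[of "cf w"] by (simp add: G_def [abs_def] Z_def)

subsection \<open>Convergence\<close>

text \<open>The hypothesis is the bound of \<open>sum_abs_cf_le\<close> for the tail. It is left as
  a hypothesis so that the induction proving that bound can use this step.\<close>

lemma abs_cf_Cons_le_aux:
  assumes "(\<Sum>m<n. \<bar>cf w m\<bar>) \<le> (1 + harm n) ^ length w"
  shows "\<bar>cf (a # w) n\<bar> \<le> (1 + harm n) ^ length w * inverse (real n)"
proof (cases "n = 0")
  case False
  have "\<bar>real n * cf (a # w) n\<bar> \<le> (1 + harm n) ^ length w"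
  proof (cases a)
    case A
    have "\<bar>cf w n\<bar> \<le> 1" by (rule abs_cf_le_1)
    also have "1 \<le> (1 + harm n :: real) ^ length w" by (rule one_le_power) (simp add: harm_nonneg)
    finally show ?thesis using A False by simp
  next
    case P
    then show ?thesis
      using False assms by (auto intro: order.trans[OF sum_abs])
  next
    case M
    have "\<bar>\<Sum>k<n. (-1) ^ k * cf w k\<bar> \<le> (\<Sum>k<n. \<bar>cf w k\<bar>)"
      by (rule order.trans[OF sum_abs]) (simp add: abs_mult power_abs)
    then show ?thesis
      using M False assms by (simp add: abs_mult power_abs)
  qed
  then show ?thesis using False by (simp add: abs_mult field_simps)
qed simp

text \<open>Each letter contributes one division by the index, hence at most one more factor of
  logarithmic size. Using \<open>1 + harm n\<close> instead of \<open>harm n\<close> covers the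
  empty word and lets the powers absorb each other.\<close>

lemma sum_abs_cf_le: "(\<Sum>m<n. \<bar>cf w m\<bar>) \<le> (1 + harm n) ^ length w"
proof (induction w arbitrary: n)
  case Nil
  show ?case by (cases n) (auto simp: sum.lessThan_Suc_shift simp del: sum.lessThan_Suc)
next
  case (Cons a w)
  have h: "harm m \<le> (harm n :: real)" if "m \<le> n" for m n :: nat
    using that unfolding harm_def by (intro sum_mono2) auto
  have h0: "harm m \<ge> (0::real)" for m :: nat by (rule harm_nonneg)
  have step: "\<bar>cf (a # w) m\<bar> \<le> (1 + harm n) ^ length w * inverse (real m)" if "m \<le> n" for m
  proof -
    have "(1 + harm m) ^ length w \<le> (1 + harm n :: real) ^ length w"
      using h[OF that] h0 by (intro power_mono) (auto simp: add_nonneg_nonneg)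
    then show ?thesis
      by (intro order.trans[OF abs_cf_Cons_le_aux[OF Cons]] mult_right_mono) auto
  qed
  have "(\<Sum>m<n. \<bar>cf (a # w) m\<bar>) \<le> (\<Sum>m<n. (1 + harm n) ^ length w * inverse (real m))"
    by (intro sum_mono step) auto
  also have "\<dots> = (1 + harm n) ^ length w * (\<Sum>m<n. inverse (real m))"
    by (simp add: sum_distrib_left)
  also have "(\<Sum>m<n. inverse (real m)) \<le> harm n"
  proof -
    have "(\<Sum>m<n. inverse (real m)) = (\<Sum>m\<in>{1..<n}. inverse (real m))"
      by (intro sum.mono_neutral_right) auto
    also have "\<dots> \<le> (\<Sum>m=1..n. inverse (real m))" by (intro sum_mono2) auto
    finally show ?thesis by (simp add: harm_def)
  qed
  also have "(1 + harm n) ^ length w * harm n \<le> (1 + harm n :: real) ^ length (a # w)"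
    using h0[of n] by (simp add: algebra_simps)
  finally show ?case using h0 by (simp add: mult_left_mono)
qed

text \<open>A single term of the exponential series is at most its sum.\<close>

lemma power_le_fact_mult_exp:
  fixes z :: real
  assumes "z \<ge> 0"
  shows "z ^ k \<le> fact k * exp z"
proof -
  have s: "(\<lambda>n. inverse (fact n) * z ^ n) sums exp z"
    using exp_converges[of z] by simp
  have "inverse (fact k) * z ^ k \<le> exp z"
    using sum_le_suminf[OF sums_summable[OF s], of "{k}"] assms sums_unique[OF s] by simp
  then show ?thesis by (simp add: field_simps)
qed

text \<open>The exponent 1/4 leaves enough room twice: n^(-2) n^(1/4) = n^(-7/4) is summable with
  tails of order N^(-1/2) or better, and N^(1/4) N^(-1/2) still tends to 0. The constant comes from
  the exponential bound at (1 + harm n)/4 together with harm n \<le> ln n + 1.\<close>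

lemma harm_power_le_root:
  obtains C where "C > 0" "\<And>n. n \<ge> 1 \<Longrightarrow> (1 + harm n :: real) ^ k \<le> C * real n powr (1/4)"
proof
  show "4 ^ k * fact k * exp (1 / 2) > (0::real)" by simp
  fix n :: nat assume n: "n \<ge> 1"
  have h: "harm n \<le> ln (real n) + 1" using decseqD[OF decseq_harm_diff_ln, of 0 "n - 1"] n by (simp add: harm_expand)
  have "(1 + harm n :: real) ^ k = 4 ^ k * ((1 + harm n) / 4) ^ k"
    by (simp add: power_divide)
  also have "\<dots> \<le> 4 ^ k * (fact k * exp ((1 + harm n) / 4))"
    using harm_nonneg[where ?'a = real, of n] by (intro mult_left_mono power_le_fact_mult_exp) auto
  also have "exp ((1 + harm n) / 4) \<le> exp (1 / 2 + ln (real n) / 4)"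
    using h by simp
  also have "\<dots> = exp (1 / 2) * real n powr (1/4)"
    using n by (simp add: exp_add powr_def)
  finally show "(1 + harm n :: real) ^ k \<le> 4 ^ k * fact k * exp (1 / 2) * real n powr (1/4)"
    by (simp add: mult_ac mult_left_mono)
qed

text \<open>For alternating terms \<open>a n\<close> the paired series converges absolutely.\<close>

lemma sums_pair_conv:
  fixes a :: "nat \<Rightarrow> real"
  assumes d: "summable (\<lambda>n. a n + a (Suc n))" and a: "a \<longlonglongrightarrow> 0"
  shows "a sums (((\<Sum>n. a n + a (Suc n)) + a 0) / 2)"
proof -
  \<comment> \<open>The pairs overlap, so every term except the two outermost ones is counted twice;
    hence the factor 1/2 in the sum.\<close>
  have "(\<Sum>n<N. a n + a (Suc n)) = 2 * (\<Sum>n<N. a n) - a 0 + a N" for N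
    by (induction N) auto
  then have *: "(\<Sum>n<N. a n) = ((\<Sum>n<N. a n + a (Suc n)) + a 0 - a N) / 2" for N by (simp add: field_simps)
  have "(\<lambda>N. ((\<Sum>n<N. a n + a (Suc n)) + a 0 - a N) / 2) \<longlonglongrightarrow> ((\<Sum>n. a n + a (Suc n)) + a 0 - 0) / 2"
    by (intro tendsto_intros summable_LIMSEQ d a) auto
  then show ?thesis unfolding sums_def * by simp
qed

text \<open>Write n^(-7/4) as n^(-5/4) n^(-1/2): the first factor is still summable, and on the tail
  the second is at most N^(-1/2).\<close>

lemma powr_tail:
  fixes d :: "nat \<Rightarrow> real"
  assumes "\<And>n. n \<ge> 1 \<Longrightarrow> \<bar>d n\<bar> \<le> C * real n powr (-7/4)"
  shows "summable d" and "\<exists>K. \<forall>N\<ge>1. \<bar>\<Sum>n. d (n + N)\<bar> \<le> K * real N powr (-1/2)"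
proof -
  have s: "summable (\<lambda>n. C * real n powr (-5/4))" "summable (\<lambda>n. C * real n powr (-7/4))"
    by (intro summable_mult; simp add: summable_real_powr_iff)+
  show sd: "summable d"
    by (rule summable_comparison_test[OF _ s(2)]) (use assms in auto)
  have "\<bar>\<Sum>n. d (n + N)\<bar> \<le> (\<Sum>n. C * real n powr (-5/4)) * real N powr (-1/2)" if N: "N \<ge> 1" for N
  proof -
    have C: "C \<ge> 0" using assms[of 1] by auto
    have b: "norm (d (n + N)) \<le> C * real (n + N) powr (-5/4) * real N powr (-1/2)" for n
    proof -
      have "norm (d (n + N)) \<le> C * real (n + N) powr (-7/4)" using assms[of "n + N"] N by simp
      also have "real (n + N) powr (-7/4) = real (n + N) powr (-5/4) * real (n + N) powr (-1/2)"
        by (simp add: powr_add[symmetric])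
      also have "C * \<dots> \<le> C * (real (n + N) powr (-5/4) * real N powr (-1/2))"
        using N C by (intro mult_left_mono powr_mono2') auto
      finally show ?thesis by simp
    qed
    have s': "summable (\<lambda>n. C * real (n + N) powr (-5/4))"
      using s(1) by (rule summable_ignore_initial_segment)
    have "norm (\<Sum>n. d (n + N)) \<le> (\<Sum>n. C * real (n + N) powr (-5/4) * real N powr (-1/2))"
      by (rule norm_suminf_le[OF b summable_mult2[OF s']])
    also have "\<dots> = (\<Sum>n. C * real (n + N) powr (-5/4)) * real N powr (-1/2)"
      by (rule suminf_mult2[OF s', symmetric])
    also have "(\<Sum>n. C * real (n + N) powr (-5/4)) \<le> (\<Sum>n. C * real n powr (-5/4))"
      using suminf_split_initial_segment[OF s(1), of N] C by (simp add: sum_nonneg)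
    finally show ?thesis by (simp add: mult_right_mono)
  qed
  then show "\<exists>K. \<forall>N\<ge>1. \<bar>\<Sum>n. d (n + N)\<bar> \<le> K * real N powr (-1/2)" by blast
qed

lemma abs_cf_Cons_le: "\<bar>cf (a # w) n\<bar> \<le> (1 + harm n) ^ length w * inverse (real n)"
  by (rule abs_cf_Cons_le_aux[OF sum_abs_cf_le])

text \<open>A leading \<open>A\<close> gives a second division by the index and thus absolute
  convergence. A leading \<open>M\<close> gives alternating terms, for which the sums of two
  neighbours are as small as the terms in the first case. A leading \<open>P\<close> is excluded
  since \<open>[P]\<close> itself is the harmonic series.\<close>

lemma cf_convergence:
  assumes "w \<noteq> []" "hd w \<noteq> P"
  shows "summable (cf w)"
    and "\<exists>K. \<forall>N\<ge>1. \<bar>Z w - (\<Sum>n<N. cf w n)\<bar> \<le> K * real N powr (-1/2)"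
proof -
  obtain a v where w: "w = a # v" using assms by (cases w) auto
  obtain C where C: "C > 0" "\<And>n. n \<ge> 1 \<Longrightarrow> (1 + harm n :: real) ^ length v \<le> C * real n powr (1/4)"
    using harm_power_le_root by blast
  have cfw: "\<bar>cf w n\<bar> \<le> C * real n powr (-3/4)" if "n \<ge> 1" for n
  proof -
    have "\<bar>cf w n\<bar> \<le> C * real n powr (1/4) * inverse (real n)"
      unfolding w using C(2)[OF that] by (intro order.trans[OF abs_cf_Cons_le] mult_right_mono) auto
    also have "\<dots> = C * (real n powr (1/4) * real n powr (-1))" using that by (simp add: powr_minus)
    also have "\<dots> = C * real n powr (-3/4)" by (simp only: powr_add[symmetric]) simp
    finally show ?thesis .
  qed
  obtain D where D: "D > 0" "\<And>n. n \<ge> 1 \<Longrightarrow> (1 + harm n :: real) ^ length (tl v) \<le> D * real n powr (1/4)"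
    using harm_power_le_root by blast
  have cfv: "\<bar>cf v n\<bar> / real n \<le> D * real n powr (-7/4)" if "n \<ge> 1" for n
  proof (cases v)
    case Nil
    then show ?thesis using that D(1) by simp
  next
    case (Cons b u)
    have "\<bar>cf v n\<bar> \<le> D * real n powr (1/4) * inverse (real n)"
      unfolding Cons using D(2)[OF that] Cons
      by (intro order.trans[OF abs_cf_Cons_le] mult_right_mono) auto
    then have "\<bar>cf v n\<bar> / real n \<le> D * real n powr (1/4) * inverse (real n) / real n"
      by (rule divide_right_mono) simp
    also have "\<dots> = D * (real n powr (1/4) * real n powr (-2))"
      using that by (simp add: powr_minus power2_eq_square field_simps)
    also have "\<dots> = D * real n powr (-7/4)" by (simp only: powr_add[symmetric]) simp
    finally show ?thesis .
  qed
  show "summable (cf w)"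
    and "\<exists>K. \<forall>N\<ge>1. \<bar>Z w - (\<Sum>n<N. cf w n)\<bar> \<le> K * real N powr (-1/2)"
  proof -
    consider "a = A" | "a = M" using assms w by (cases a) auto
    then have "summable (cf w) \<and> (\<exists>K. \<forall>N\<ge>1. \<bar>Z w - (\<Sum>n<N. cf w n)\<bar> \<le> K * real N powr (-1/2))"
    proof cases
      case 1
      have b: "\<bar>cf w n\<bar> \<le> D * real n powr (-7/4)" if "n \<ge> 1" for n
        using cfv[OF that] that w 1 by simp
      note t = powr_tail[of "cf w", OF b]
      have "Z w - (\<Sum>n<N. cf w n) = (\<Sum>n. cf w (n + N))" for N
        unfolding Z_def by (rule suminf_minus_initial_segment[OF t(1), symmetric])
      with t show ?thesis by simp
    next
      case 2
      define d where "d n = cf w n + cf w (Suc n)" for n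
      define u where "u n = (\<Sum>m<n. (-1) ^ m * cf v m)" for n
      have u: "\<bar>u n\<bar> \<le> C * real n powr (1/4)" if "n \<ge> 1" for n
      proof -
        have "\<bar>u n\<bar> \<le> (\<Sum>m<n. \<bar>cf v m\<bar>)" unfolding u_def
          by (rule order.trans[OF sum_abs]) (simp add: abs_mult power_abs)
        then show ?thesis using sum_abs_cf_le[of v n] C(2)[OF that] by linarith
      qed
      have cw: "cf w n = (-1) ^ n * u n / real n" for n using w 2 by (simp add: u_def)
      \<comment> \<open>The alternating signs turn the sum of neighbours into a difference. Either
        1/n - 1/(n+1) provides the second power of 1/n, or the increment of \<open>u\<close> does,
        being a coefficient of \<open>v\<close>.\<close>
      have b: "\<bar>d n\<bar> \<le> (C + D) * real n powr (-7/4)" if n: "n \<ge> 1" for n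
      proof -
        have "u (Suc n) = u n + (-1) ^ n * cf v n" by (simp add: u_def)
        then have "d n = (-1) ^ n * (u n / real n - u n / real (Suc n))
            - (-1) ^ n * (-1) ^ n * cf v n / real (Suc n)"
          unfolding d_def cw by (simp add: algebra_simps add_divide_distrib diff_divide_distrib)
        also have "u n / real n - u n / real (Suc n) = u n / (real n * real (Suc n))"
          using n by (simp add: field_simps)
        finally have "d n = (-1) ^ n * (u n / (real n * real (Suc n))) - cf v n / real (Suc n)"
          by (simp add: power_mult_distrib[symmetric])
        then have "\<bar>d n\<bar> \<le> \<bar>u n\<bar> / (real n * real (Suc n)) + \<bar>cf v n\<bar> / real (Suc n)"
          by (auto intro!: order.trans[OF abs_triangle_ineq4] simp: abs_mult power_abs)
        also have "\<bar>u n\<bar> / (real n * real (Suc n)) \<le> C * real n powr (1/4) / (real n * real n)"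
          using u[OF n] n C(1) by (intro frac_le mult_mono) auto
        also have "\<dots> = C * (real n powr (1/4) * real n powr (-2))"
          using n by (simp add: powr_minus power2_eq_square field_simps)
        also have "\<dots> = C * real n powr (-7/4)" by (simp only: powr_add[symmetric]) simp
        also have "\<bar>cf v n\<bar> / real (Suc n) \<le> \<bar>cf v n\<bar> / real n"
          using n by (intro divide_left_mono) auto
        also have "\<dots> \<le> D * real n powr (-7/4)" by (rule cfv[OF n])
        finally show ?thesis by (simp add: algebra_simps)
      qed
      note t = powr_tail[of d, OF b]
      have z: "cf w \<longlonglongrightarrow> 0"
      proof (rule Lim_null_comparison)
        show "\<forall>\<^sub>F n in sequentially. norm (cf w n) \<le> C * real n powr (-3/4)"
          using cfw by (intro eventually_sequentiallyI[of 1]) auto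
        show "(\<lambda>n. C * real n powr (-3/4)) \<longlonglongrightarrow> 0"
          by (intro tendsto_mult_right_zero tendsto_neg_powr filterlim_real_sequentially) auto
      qed
      have sw: "cf w sums ((suminf d + cf w 0) / 2)"
        using sums_pair_conv[of "cf w"] t(1) z by (simp add: d_def [abs_def])
      have sd: "(\<Sum>n<N. d n) = 2 * (\<Sum>n<N. cf w n) - cf w 0 + cf w N" for N
        by (induction N) (auto simp: d_def)
      have tail: "Z w - (\<Sum>n<N. cf w n) = ((\<Sum>n. d (n + N)) + cf w N) / 2" for N
        using suminf_minus_initial_segment[OF t(1), of N] sd[of N] sums_unique[OF sw]
        by (simp add: Z_def field_simps)
      obtain K where K: "\<And>N. N \<ge> 1 \<Longrightarrow> \<bar>\<Sum>n. d (n + N)\<bar> \<le> K * real N powr (-1/2)"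
        using t(2) by blast
      have "\<bar>Z w - (\<Sum>n<N. cf w n)\<bar> \<le> (K + C) * real N powr (-1/2)" if N: "N \<ge> 1" for N
      proof -
        have "C * real N powr (-3/4) \<le> C * real N powr (-1/2)"
          using N C(1) by (intro mult_left_mono powr_mono) auto
        then have "\<bar>(\<Sum>n. d (n + N)) + cf w N\<bar> \<le> K * real N powr (-1/2) + C * real N powr (-1/2)"
          using K[OF N] cfw[OF N] by linarith
        then show ?thesis
          unfolding tail by (simp add: abs_divide algebra_simps)
      qed
      with sums_summable[OF sw] show ?thesis by blast
    qed
    then show "summable (cf w)"
      and "\<exists>K. \<forall>N\<ge>1. \<bar>Z w - (\<Sum>n<N. cf w n)\<bar> \<le> K * real N powr (-1/2)" by blast+
  qed
qed

subsection \<open>Shuffle products\<close>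

fun shuf :: "'a list \<Rightarrow> 'a list \<Rightarrow> 'a list list" where
  "shuf [] v = [v]"
| "shuf u [] = [u]"
| "shuf (a # u) (b # v) = map ((#) a) (shuf u (b # v)) @ map ((#) b) (shuf (a # u) v)"

text \<open>A list of pairs of a coefficient and an object stands for a formal linear combination,
  in which objects may be repeated; \<open>lsum f\<close> is the linear extension of
  \<open>f\<close>.\<close>

definition lsum :: "('a \<Rightarrow> real) \<Rightarrow> (real \<times> 'a) list \<Rightarrow> real" where
  "lsum f xs = (\<Sum>(c, w)\<leftarrow>xs. c * f w)"

text \<open>Pullback of an iterated integral: \<open>\<sigma> a\<close> expresses the pulled back
  form of the letter \<open>a\<close> through the letters again, and the word is expanded
  multilinearly.\<close>

fun subst :: "('a \<Rightarrow> (real \<times> 'a) list) \<Rightarrow> 'a list \<Rightarrow> (real \<times> 'a list) list" where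
  "subst \<sigma> [] = [(1, [])]"
| "subst \<sigma> (a # w) = concat (map (\<lambda>(s, b). map (\<lambda>(c, u). (s * c, b # u)) (subst \<sigma> w)) (\<sigma> a))"

lemma lsum_simps [simp]:
  "lsum f [] = 0" "lsum f ((c, w) # xs) = c * f w + lsum f xs" "lsum f (xs @ ys) = lsum f xs + lsum f ys"
  by (simp_all add: lsum_def)

lemma lsum_mult_left: "c * lsum f xs = lsum (\<lambda>w. c * f w) xs"
  by (induction xs) (auto simp: algebra_simps)

lemma lsum_mult_right: "lsum f xs * c = lsum (\<lambda>w. f w * c) xs"
  by (induction xs) (auto simp: algebra_simps)

lemma lsum_subst_Cons:
  "lsum f (subst \<sigma> (a # w)) = lsum (\<lambda>b. lsum (\<lambda>u. f (b # u)) (subst \<sigma> w)) (\<sigma> a)"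
proof -
  have *: "lsum f (map (\<lambda>(c, u). (s * c, b # u)) xs) = s * lsum (\<lambda>u. f (b # u)) xs" for s b xs
    by (induction xs) (auto simp: algebra_simps)
  have "lsum f (concat (map (\<lambda>(s, b). map (\<lambda>(c, u). (s * c, b # u)) (subst \<sigma> w)) ys)) =
      lsum (\<lambda>b. lsum (\<lambda>u. f (b # u)) (subst \<sigma> w)) ys" for ys
    by (induction ys) (auto simp: *)
  then show ?thesis by simp
qed

lemma length_subst: "u \<in> snd ` set (subst \<sigma> w) \<Longrightarrow> length u = length w"
  by (induction w arbitrary: u) force+

lemma DERIV_lsum:
  "(\<And>w. w \<in> snd ` set xs \<Longrightarrow> (f w has_real_derivative g w) (at x)) \<Longrightarrow>
    ((\<lambda>x. lsum (\<lambda>w. f w x) xs) has_real_derivative lsum g xs) (at x)"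
  by (induction xs) (auto intro!: DERIV_add DERIV_cmult)

lemma tendsto_lsum:
  "(\<And>w. w \<in> snd ` set xs \<Longrightarrow> (f w \<longlongrightarrow> g w) F) \<Longrightarrow>
    ((\<lambda>x. lsum (\<lambda>w. f w x) xs) \<longlongrightarrow> lsum g xs) F"
  by (induction xs) (auto intro!: tendsto_intros)

lemma continuous_on_lsum:
  "(\<And>w. w \<in> snd ` set xs \<Longrightarrow> continuous_on S (f w)) \<Longrightarrow>
    continuous_on S (\<lambda>x. lsum (\<lambda>w. f w x) xs)"
  by (induction xs) (auto intro!: continuous_intros)

lemma DERIV_sum_list:
  fixes f :: "'a \<Rightarrow> real \<Rightarrow> real"
  shows "(\<And>w. w \<in> set xs \<Longrightarrow> (f w has_real_derivative g w) (at x)) \<Longrightarrow>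
    ((\<lambda>x. \<Sum>w\<leftarrow>xs. f w x) has_real_derivative (\<Sum>w\<leftarrow>xs. g w)) (at x)"
  by (induction xs) (auto intro!: derivative_eq_intros)

lemma tendsto_sum_list:
  fixes f :: "'a \<Rightarrow> 'b \<Rightarrow> real"
  shows "(\<And>w. w \<in> set xs \<Longrightarrow> (f w \<longlongrightarrow> g w) F) \<Longrightarrow>
    ((\<lambda>x. \<Sum>w\<leftarrow>xs. f w x) \<longlongrightarrow> (\<Sum>w\<leftarrow>xs. g w)) F"
  by (induction xs) (auto intro!: tendsto_intros)

lemma continuous_on_sum_list:
  fixes f :: "'a \<Rightarrow> real \<Rightarrow> real"
  shows "(\<And>w. w \<in> set xs \<Longrightarrow> continuous_on S (f w)) \<Longrightarrow>
    continuous_on S (\<lambda>x. \<Sum>w\<leftarrow>xs. f w x)"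
  by (induction xs) (auto intro!: continuous_intros)

lemma continuous_on_G: "continuous_on {0..<1} (G w)"
  by (intro continuous_at_imp_continuous_on ballI isCont_G) auto

text \<open>Differentiability is required only inside the interval, because \<open>form A\<close>
  has a pole at 0; continuity and the common initial value take care of that end.\<close>

lemma eq_if_deriv_eq:
  fixes f g :: "real \<Rightarrow> real"
  assumes "continuous_on {0..<1} f" "continuous_on {0..<1} g" "f 0 = g 0"
    and "\<And>x. 0 < x \<Longrightarrow> x < 1 \<Longrightarrow> (f has_real_derivative d x) (at x)"
    and "\<And>x. 0 < x \<Longrightarrow> x < 1 \<Longrightarrow> (g has_real_derivative d x) (at x)"
    and "0 \<le> x" "x < 1"
  shows "f x = g x"
proof (cases "x = 0")
  case False
  have "continuous_on {0..x} (\<lambda>x. f x - g x)"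
    using assms by (intro continuous_on_diff continuous_on_subset[OF assms(1)] continuous_on_subset[OF assms(2)]) auto
  moreover have "((\<lambda>x. f x - g x) has_real_derivative 0) (at y)" if "0 < y" "y < x" for y
    using DERIV_diff[OF assms(4,5)[of y]] that assms by simp
  ultimately have "f x - g x = f 0 - g 0"
    using False assms DERIV_isconst_end[of 0 x "\<lambda>x. f x - g x"] by simp
  then show ?thesis using assms by simp
qed (use assms in auto)

lemma shuf_length: "w \<in> set (shuf u v) \<Longrightarrow> length w = length u + length v"
  by (induction u v arbitrary: w rule: shuf.induct) auto

lemma shuf_hd: "w \<in> set (shuf u v) \<Longrightarrow> u \<noteq> [] \<Longrightarrow> v \<noteq> [] \<Longrightarrow> hd w = hd u \<or> hd w = hd v"
  by (cases u; cases v) auto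

text \<open>By the product rule the derivative of the product has one summand for each of the two
  outermost forms, which is exactly the recursion of \<open>shuf\<close>; both sides vanish at
  0.\<close>

lemma G_shuffle:
  assumes "u = [] \<or> last u \<noteq> A" "v = [] \<or> last v \<noteq> A" "0 \<le> x" "x < 1"
  shows "G u x * G v x = (\<Sum>w\<leftarrow>shuf u v. G w x)"
  using assms
proof (induction u v arbitrary: x rule: shuf.induct)
  case (3 a u b v)
  show ?case
  proof (rule eq_if_deriv_eq[where f = "\<lambda>x. G (a # u) x * G (b # v) x"])
    fix x :: real assume x: "0 < x" "x < 1"
    have "((\<lambda>x. G (a # u) x * G (b # v) x) has_real_derivative
        (form a x * G u x) * G (b # v) x + (form b x * G v x) * G (a # u) x) (at x)"
      using 3(3,4) x by (intro DERIV_mult G_deriv) auto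
    then show "((\<lambda>x. G (a # u) x * G (b # v) x) has_real_derivative
        (form a x * (G u x * G (b # v) x) + form b x * (G (a # u) x * G v x))) (at x)"
      by (simp add: mult_ac)
    have IH: "G u x * G (b # v) x = (\<Sum>w\<leftarrow>shuf u (b # v). G w x)"
      "G (a # u) x * G v x = (\<Sum>w\<leftarrow>shuf (a # u) v. G w x)"
      using 3 x by (auto split: if_splits)
    show "((\<lambda>x. \<Sum>w\<leftarrow>shuf (a # u) (b # v). G w x) has_real_derivative
        (form a x * (G u x * G (b # v) x) + form b x * (G (a # u) x * G v x))) (at x)"
      unfolding IH sum_list_const_mult[symmetric]
      using x shuf_length[of "[]" u "b # v"] shuf_length[of "[]" "a # u" v]
      by (auto simp: o_def intro!: DERIV_add DERIV_sum_list G_deriv)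
  qed (use 3(5,6) in \<open>auto intro!: continuous_intros continuous_on_sum_list continuous_on_G simp: o_def\<close>)
qed auto

lemma summable_shuf:
  assumes "u \<noteq> []" "v \<noteq> []" "hd u \<noteq> P" "hd v \<noteq> P" "w \<in> set (shuf u v)"
  shows "summable (cf w)"
proof (rule cf_convergence(1))
  show "w \<noteq> []" using shuf_length[OF assms(5)] assms by auto
  show "hd w \<noteq> P" using shuf_hd[OF assms(5)] assms by auto
qed

text \<open>A leading \<open>P\<close> threatens convergence at 1, a final \<open>A\<close> at
  0.\<close>

definition admissible :: "letter list \<Rightarrow> bool" where
  "admissible w \<longleftrightarrow> w \<noteq> [] \<and> hd w \<noteq> P \<and> last w \<noteq> A"

lemma eventually_at_left_1: "\<forall>\<^sub>F x::real in at_left 1. 0 < x \<and> x < 1"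
  using eventually_at_left_real[of 0 1] by (auto elim: eventually_mono)

lemma Z_shuffle:
  assumes "admissible u" "admissible v"
  shows "Z u * Z v = (\<Sum>w\<leftarrow>shuf u v. Z w)"
proof -
  note ad = assms[unfolded admissible_def]
  have "((\<lambda>x. \<Sum>w\<leftarrow>shuf u v. G w x) \<longlongrightarrow> (\<Sum>w\<leftarrow>shuf u v. Z w)) (at_left 1)"
    by (intro tendsto_sum_list G_tendsto_Z summable_shuf[of u v]) (use ad in auto)
  moreover have "((\<lambda>x. G u x * G v x) \<longlongrightarrow> Z u * Z v) (at_left 1)"
    by (intro tendsto_mult G_tendsto_Z cf_convergence(1)) (use ad in auto)
  then have "((\<lambda>x. \<Sum>w\<leftarrow>shuf u v. G w x) \<longlongrightarrow> Z u * Z v) (at_left 1)"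
    by (rule Lim_transform_eventually)
      (use eventually_at_left_1 in eventually_elim, use G_shuffle[of u v] ad in auto)
  ultimately show ?thesis
    using tendsto_unique[OF trivial_limit_at_left_real] by blast
qed

subsection \<open>Changes of variables\<close>

lemma lsum_0: "lsum (\<lambda>w. 0) xs = 0"
  by (induction xs) auto

text \<open>The chain rule, applied to one letter after the other. \<open>S\<close> collects the
  letters whose pullback is again a combination of letters. Letters other than \<open>A\<close> must
  have images free of \<open>A\<close>, so that no pole at 0 is created at the innermost
  form.\<close>

lemma G_subst:
  fixes \<phi> \<phi>' :: "real \<Rightarrow> real"
  assumes "continuous_on {0..<1} \<phi>" "\<phi> 0 = 0"
    and \<phi>: "\<And>x. 0 < x \<Longrightarrow> x < 1 \<Longrightarrow> 0 < \<phi> x \<and> \<phi> x < 1"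
    and deriv: "\<And>x. 0 < x \<Longrightarrow> x < 1 \<Longrightarrow> (\<phi> has_real_derivative \<phi>' x) (at x)"
    and form: "\<And>a x. a \<in> S \<Longrightarrow> 0 < x \<Longrightarrow> x < 1 \<Longrightarrow>
      form a (\<phi> x) * \<phi>' x = lsum (\<lambda>b. form b x) (\<sigma> a)"
    and \<sigma>: "\<And>a. a \<in> S \<Longrightarrow> a \<noteq> A \<Longrightarrow> A \<notin> snd ` set (\<sigma> a)"
    and "set w \<subseteq> S" "w = [] \<or> last w \<noteq> A" "0 \<le> x" "x < 1"
  shows "G w (\<phi> x) = lsum (\<lambda>u. G u x) (subst \<sigma> w)"
  using assms(7-)
proof (induction w arbitrary: x)
  case (Cons a w)
  have \<phi>1: "0 \<le> \<phi> x \<and> \<phi> x < 1" if "0 \<le> x" "x < 1" for x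
    using \<phi>[of x] that assms(2) by (cases "x = 0") auto
  define F where "F x = lsum (\<lambda>b. lsum (\<lambda>u. G (b # u) x) (subst \<sigma> w)) (\<sigma> a)" for x
  have "G (a # w) (\<phi> x) = F x"
  proof (rule eq_if_deriv_eq[where f = "\<lambda>x. G (a # w) (\<phi> x)" and
        d = "\<lambda>x. (form a (\<phi> x) * G w (\<phi> x)) * \<phi>' x"])
    show "continuous_on {0..<1} (\<lambda>x. G (a # w) (\<phi> x))"
      by (rule continuous_on_compose2[OF continuous_on_G assms(1)]) (use \<phi>1 in auto)
    show "continuous_on {0..<1} F"
      unfolding F_def by (intro continuous_on_lsum continuous_on_G)
    show "G (a # w) (\<phi> 0) = F 0" using assms(2) by (simp add: F_def lsum_0)
    fix x :: real assume x: "0 < x" "x < 1"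
    show "((\<lambda>x. G (a # w) (\<phi> x)) has_real_derivative
        (form a (\<phi> x) * G w (\<phi> x)) * \<phi>' x) (at x)"
      using Cons.prems \<phi>[OF x] by (intro DERIV_chain2[OF G_deriv] deriv x) auto
    \<comment> \<open>If \<open>w\<close> is empty then \<open>a\<close> is the innermost letter, so
      its image contains no \<open>A\<close>; otherwise \<open>u\<close> has the positive length of
      \<open>w\<close>.\<close>
    have ne: "b # u \<noteq> [A]" if "b \<in> snd ` set (\<sigma> a)" "u \<in> snd ` set (subst \<sigma> w)" for b u
      using length_subst[OF that(2)] \<sigma>[of a] that(1) Cons.prems(1,2) by force
    have "(F has_real_derivative
        lsum (\<lambda>b. lsum (\<lambda>u. form b x * G u x) (subst \<sigma> w)) (\<sigma> a)) (at x)"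
      unfolding F_def using ne x by (intro DERIV_lsum G_deriv) auto
    also have "lsum (\<lambda>b. lsum (\<lambda>u. form b x * G u x) (subst \<sigma> w)) (\<sigma> a) =
        lsum (\<lambda>b. form b x) (\<sigma> a) * lsum (\<lambda>u. G u x) (subst \<sigma> w)"
      unfolding lsum_mult_left[symmetric] lsum_mult_right ..
    also have "lsum (\<lambda>u. G u x) (subst \<sigma> w) = G w (\<phi> x)"
      using Cons.IH[of x] Cons.prems(1,2) x by (auto split: if_splits)
    also have "lsum (\<lambda>b. form b x) (\<sigma> a) = form a (\<phi> x) * \<phi>' x"
      using form[of a x] Cons.prems(1) x by simp
    finally show "(F has_real_derivative (form a (\<phi> x) * G w (\<phi> x)) * \<phi>' x) (at x)"
      by (simp add: mult_ac)
  qed (use Cons.prems in auto)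
  then show ?case unfolding F_def lsum_subst_Cons .
qed simp

text \<open>
  The substitution \<open>t = x\<^sup>2\<close> maps \<open>dt/t\<close> to \<open>2 dx/x\<close> and \<open>dt/(1 - t)\<close> to
  \<open>dx/(1 - x) - dx/(1 + x)\<close>. It does not act on \<open>M\<close>, whose image is a dummy.
\<close>

fun square_subst :: "letter \<Rightarrow> (real \<times> letter) list" where
  "square_subst A = [(2, A)]"
| "square_subst P = [(1, P), (1, M)]"
| "square_subst M = []"

text \<open>The leading \<open>A\<close> is kept apart because its image is twice itself: every word
  on the right then begins with \<open>A\<close> too, so that both sides converge at 1.\<close>

lemma Z_doubling:
  assumes "set w \<subseteq> {A, P}" "w \<noteq> []" "last w \<noteq> A"
  shows "Z (A # w) = 2 * lsum (\<lambda>u. Z (A # u)) (subst square_subst w)"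
proof -
  have eq: "G (A # w) (x ^ 2) = 2 * lsum (\<lambda>u. G (A # u) x) (subst square_subst w)"
    if x: "0 < x" "x < 1" for x
  proof -
    have "G (A # w) (x ^ 2) = lsum (\<lambda>u. G u x) (subst square_subst (A # w))"
    proof (rule G_subst[where \<phi>' = "\<lambda>x. 2 * x" and S = "{A, P}"])
      show "((\<lambda>x. x ^ 2) has_real_derivative 2 * x) (at x)" for x :: real
        by (auto intro!: derivative_eq_intros)
      show "form a (x ^ 2) * (2 * x) = lsum (\<lambda>b. form b x) (square_subst a)"
        if "a \<in> {A, P}" "0 < x" "x < 1" for a x
      proof -
        have "1 - x\<^sup>2 = (1 - x) * (1 + x)" by algebra
        moreover have "1 / (1 - x) - 1 / (1 + x) = 2 * x / ((1 - x) * (1 + x))"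
          using that by (simp add: divide_simps) 
        ultimately show ?thesis using that by (auto simp: power2_eq_square)
      qed
    qed (use assms x in \<open>auto intro!: continuous_intros simp: power_less_one_iff\<close>)
    then show ?thesis by (simp add: lsum_subst_Cons del: subst.simps)
  qed
  have lim: "filterlim (\<lambda>x::real. x ^ 2) (at_left 1) (at_left 1)"
  proof (rule tendsto_imp_filterlim_at_left)
    have "((\<lambda>x::real. x ^ 2) \<longlongrightarrow> 1 ^ 2) (at_left 1)" by (intro tendsto_intros)
    then show "((\<lambda>x::real. x ^ 2) \<longlongrightarrow> 1) (at_left 1)" by simp
    show "\<forall>\<^sub>F x::real in at_left 1. x ^ 2 < 1"
      using eventually_at_left_1 by eventually_elim (simp add: power_less_one_iff)
  qed
  have "((\<lambda>x. G (A # w) (x ^ 2)) \<longlongrightarrow> Z (A # w)) (at_left 1)"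
    by (rule filterlim_compose[OF G_tendsto_Z lim]) (rule cf_convergence(1), auto)
  then have "((\<lambda>x. 2 * lsum (\<lambda>u. G (A # u) x) (subst square_subst w)) \<longlongrightarrow> Z (A # w)) (at_left 1)"
    by (rule Lim_transform_eventually) (use eventually_at_left_1 in eventually_elim, use eq in auto)
  moreover have "((\<lambda>x. 2 * lsum (\<lambda>u. G (A # u) x) (subst square_subst w)) \<longlongrightarrow>
      2 * lsum (\<lambda>u. Z (A # u)) (subst square_subst w)) (at_left 1)"
    by (intro tendsto_mult_left tendsto_lsum G_tendsto_Z cf_convergence(1)) auto
  ultimately show ?thesis
    using tendsto_unique[OF trivial_limit_at_left_real] by blast
qed

text \<open>The substitution \<open>t = x/(1 + x)\<close>; again the image of \<open>M\<close> is a dummy.\<close>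

fun landen_subst :: "letter \<Rightarrow> (real \<times> letter) list" where
  "landen_subst A = [(1, A), (1, M)]"
| "landen_subst P = [(-1, M)]"
| "landen_subst M = []"

text \<open>Only \<open>P\<close> has a pole at 1. Since the images avoid it, all resulting words
  converge at 1, which is the point mapped to 1/2.\<close>

lemma landen_subst_no_P: "u \<in> snd ` set (subst landen_subst w) \<Longrightarrow> P \<notin> set u"
proof (induction w arbitrary: u)
  case (Cons a w)
  then show ?case by (cases a) force+
qed auto

lemma G_half_landen:
  assumes "set w \<subseteq> {A, P}" "w \<noteq> []" "last w \<noteq> A"
  shows "G w (1 / 2) = lsum Z (subst landen_subst w)"
proof -
  have eq: "G w (x / (1 + x)) = lsum (\<lambda>u. G u x) (subst landen_subst w)"
    if x: "0 < x" "x < 1" for x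
  proof (rule G_subst[where \<phi>' = "\<lambda>x. 1 / (1 + x)\<^sup>2" and S = "{A, P}"])
    show "((\<lambda>x. x / (1 + x)) has_real_derivative 1 / (1 + x)\<^sup>2) (at x)" if "0 < x" for x :: real
      using that by (auto intro!: derivative_eq_intros simp: power2_eq_square divide_simps)
    show "form a (x / (1 + x)) * (1 / (1 + x)\<^sup>2) = lsum (\<lambda>b. form b x) (landen_subst a)"
      if "a \<in> {A, P}" "0 < x" "x < 1" for a x
      using that by (auto simp: power2_eq_square divide_simps)
  qed (use assms x in \<open>auto intro!: continuous_intros\<close>)
  have "isCont (G w) (1 / 2)" by (rule isCont_G) simp
  moreover have "((\<lambda>x::real. x / (1 + x)) \<longlongrightarrow> 1 / (1 + 1)) (at_left 1)"
    by (intro tendsto_intros) auto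
  ultimately have "((\<lambda>x. G w (x / (1 + x))) \<longlongrightarrow> G w (1 / 2)) (at_left 1)"
    by (auto intro: isCont_tendsto_compose)
  then have "((\<lambda>x. lsum (\<lambda>u. G u x) (subst landen_subst w)) \<longlongrightarrow> G w (1 / 2)) (at_left 1)"
    by (rule Lim_transform_eventually) (use eventually_at_left_1 in eventually_elim, use eq in auto)
  moreover have "((\<lambda>x. lsum (\<lambda>u. G u x) (subst landen_subst w)) \<longlongrightarrow> lsum Z (subst landen_subst w)) (at_left 1)"
  proof (intro tendsto_lsum G_tendsto_Z cf_convergence(1))
    fix u assume u: "u \<in> snd ` set (subst landen_subst w)"
    show "u \<noteq> []" using length_subst[OF u] assms by auto
    then show "hd u \<noteq> P" using landen_subst_no_P[OF u] hd_in_set by metis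
  qed
  ultimately show ?thesis
    using tendsto_unique[OF trivial_limit_at_left_real] by blast
qed

subsection \<open>Nested sums\<close>

text \<open>
  An integer \<open>s\<close> encodes the summand \<open>1 / m ^ s\<close> if positive and the alternating summand
  \<open>(-1) ^ m / m ^ \<bar>s\<bar>\<close> if negative (usually written with a bar).
\<close>

definition sg :: "int \<Rightarrow> real" where "sg s = (if s < 0 then -1 else 1)"

fun S :: "int list \<Rightarrow> nat \<Rightarrow> real" where
  "S [] n = 1"
| "S (s # ss) n = (\<Sum>m=1..n. sg s ^ m / real m ^ nat \<bar>s\<bar> * S ss (m - 1))"

text \<open>
  The letters record the cumulative product of the signs of the exponents; the Boolean flag
  says whether the product of the preceding ones is positive.
\<close>

fun word :: "bool \<Rightarrow> int list \<Rightarrow> letter list" where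
  "word p [] = []"
| "word p (s # ss) = replicate (nat \<bar>s\<bar> - 1) A @
     (if (s < 0) = p then M else P) # word ((s < 0) \<noteq> p) ss"

section \<open>Quasi-shuffle product of nested sums\<close>

definition bar_plus :: "int \<Rightarrow> int \<Rightarrow> int" where
  "bar_plus s t = sgn s * sgn t * (\<bar>s\<bar> + \<bar>t\<bar>)"

text \<open>The three branches say which outermost index is larger; in the third one both coincide
  and their summands merge.\<close>

fun stuffle :: "int list \<Rightarrow> int list \<Rightarrow> int list list" where
  "stuffle [] v = [v]"
| "stuffle u [] = [u]"
| "stuffle (s # u) (t # v) = map ((#) s) (stuffle u (t # v)) @ map ((#) t) (stuffle (s # u) v)
     @ map ((#) (bar_plus s t)) (stuffle u v)"

lemma sum_list_S_Cons:
  "(\<Sum>w\<leftarrow>map ((#) s) ws. S w (Suc n)) =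
    (\<Sum>w\<leftarrow>map ((#) s) ws. S w n) + sg s ^ Suc n / real (Suc n) ^ nat \<bar>s\<bar> * (\<Sum>w\<leftarrow>ws. S w n)"
  by (induction ws) (auto simp: algebra_simps add_divide_distrib)

lemma S_Cons_Suc: "S (s # u) (Suc n) = S (s # u) n + sg s ^ Suc n / real (Suc n) ^ nat \<bar>s\<bar> * S u n"
  by simp

lemma S_Cons_0: "(\<Sum>w\<leftarrow>map ((#) s) ws. S w 0) = 0"
  by (induction ws) auto

lemma sg_bar_plus:
  assumes "s \<noteq> 0" "t \<noteq> 0"
  shows "sg (bar_plus s t) ^ n / real n ^ nat \<bar>bar_plus s t\<bar> =
    (sg s ^ n / real n ^ nat \<bar>s\<bar>) * (sg t ^ n / real n ^ nat \<bar>t\<bar>)"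
proof -
  have "nat \<bar>bar_plus s t\<bar> = nat \<bar>s\<bar> + nat \<bar>t\<bar>"
    using assms by (auto simp: bar_plus_def abs_mult abs_sgn_eq nat_add_distrib)
  moreover have "sg (bar_plus s t) = sg s * sg t"
    using assms by (auto simp: bar_plus_def sg_def sgn_if)
  ultimately show ?thesis by (simp add: power_add power_mult_distrib)
qed

text \<open>Raising the upper bound by one adds an increment to either factor. The two mixed
  products and the product of the increments are what the three branches of \<open>stuffle\<close>
  contribute.\<close>

lemma S_stuffle:
  assumes "0 \<notin> set u" "0 \<notin> set v"
  shows "S u n * S v n = (\<Sum>w\<leftarrow>stuffle u v. S w n)"
  using assms
proof (induction u v arbitrary: n rule: stuffle.induct)
  case (3 s u t v)
  show ?case
  proof (induction n)
    case 0
    show ?case by (simp add: S_Cons_0 del: map_map)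
  next
    case (Suc n)
    define a where "a = sg s ^ Suc n / real (Suc n) ^ nat \<bar>s\<bar>"
    define b where "b = sg t ^ Suc n / real (Suc n) ^ nat \<bar>t\<bar>"
    have m: "sg (bar_plus s t) ^ Suc n / real (Suc n) ^ nat \<bar>bar_plus s t\<bar> = a * b"
      unfolding a_def b_def by (rule sg_bar_plus) (use 3 in auto)
    have IH: "(\<Sum>w\<leftarrow>stuffle u (t # v). S w n) = S u n * S (t # v) n"
      "(\<Sum>w\<leftarrow>stuffle (s # u) v. S w n) = S (s # u) n * S v n"
      "(\<Sum>w\<leftarrow>stuffle u v. S w n) = S u n * S v n"
      using 3 by (auto simp del: S.simps)
    have "S (s # u) (Suc n) * S (t # v) (Suc n) =
        (S (s # u) n + a * S u n) * (S (t # v) n + b * S v n)"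
      unfolding S_Cons_Suc a_def b_def ..
    also have "\<dots> = S (s # u) n * S (t # v) n + a * (S u n * S (t # v) n)
        + b * (S (s # u) n * S v n) + a * b * (S u n * S v n)"
      by (simp only: algebra_simps)
    also have "\<dots> = (\<Sum>w\<leftarrow>stuffle (s # u) (t # v). S w (Suc n))"
      unfolding Suc.IH stuffle.simps map_append sum_list_append sum_list_S_Cons m
        a_def[symmetric] b_def[symmetric] IH by (simp only: algebra_simps)
    finally show ?case .
  qed
qed auto

lemma cf_replicate_A: "cf (replicate k A @ w) n = cf w n / real n ^ k"
  by (induction k) auto

text \<open>The letter \<open>M\<close> puts the sign (-1)^m into the inner sum, so the induction
  needs partial sums twisted by the sign that the flag records. For a true flag the twist
  disappears.\<close>

lemma partial_sum_cf_word:
  assumes "0 \<notin> set ss"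
  shows "(\<Sum>m\<le>N. (if p then 1 else -1) ^ m * cf (word p ss) m) = S ss N"
  using assms
proof (induction ss arbitrary: p N)
  case Nil
  show ?case by (induction N) auto
next
  case (Cons s ss)
  \<comment> \<open>The flag behind \<open>s\<close>: the letter chosen for \<open>s\<close> is
    \<open>M\<close> exactly if \<open>q\<close> is false, and the twists before and behind it
    multiply to \<open>sg s\<close>.\<close>
  define q where "q = ((s < 0) \<noteq> p)"
  let ?e = "\<lambda>p. (if p then 1 else -1 :: real)"
  have eq: "?e p ^ Suc n * cf (word p (s # ss)) (Suc n) =
      sg s ^ Suc n / real (Suc n) ^ nat \<bar>s\<bar> * S ss n" for n
  proof -
    have IH: "(\<Sum>m<Suc n. ?e q ^ m * cf (word q ss) m) = S ss n"
      using Cons.IH[of q n] Cons.prems by (simp only: lessThan_Suc_atMost) simp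
    have "cf ((if (s < 0) = p then M else P) # word q ss) (Suc n) =
        ?e q ^ Suc n * (\<Sum>m<Suc n. ?e q ^ m * cf (word q ss) m) / real (Suc n)"
      by (cases "(s < 0) = p") (auto simp: q_def simp del: sum.lessThan_Suc)
    then have "cf (word p (s # ss)) (Suc n) = ?e q ^ Suc n * S ss n / (real (Suc n) * real (Suc n) ^ (nat \<bar>s\<bar> - 1))"
      unfolding word.simps cf_replicate_A IH q_def[symmetric] by simp
    also have "real (Suc n) * real (Suc n) ^ (nat \<bar>s\<bar> - 1) = real (Suc n) ^ nat \<bar>s\<bar>"
    proof -
      have "nat \<bar>s\<bar> = Suc (nat \<bar>s\<bar> - 1)" using Cons.prems by auto
      then show ?thesis by (metis power_Suc)
    qed
    finally have "?e p ^ Suc n * cf (word p (s # ss)) (Suc n) =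
        (?e p * ?e q) ^ Suc n / real (Suc n) ^ nat \<bar>s\<bar> * S ss n"
      by (simp only: power_mult_distrib times_divide_eq_right mult_ac times_divide_eq_left)
    also have "?e p * ?e q = sg s" by (auto simp: q_def sg_def)
    finally show ?thesis .
  qed
  have "cf (word p (s # ss)) 0 = 0" by (rule cf_0) simp
  then show ?case
  proof (induction N)
    case (Suc N)
    then show ?case unfolding sum.atMost_Suc eq S_Cons_Suc by simp
  qed simp
qed

lemma S_conv_partial_sum:
  "0 \<notin> set ss \<Longrightarrow> S ss N = (\<Sum>m<Suc N. cf (word True ss) m)"
  using partial_sum_cf_word[of ss True N] by (simp add: lessThan_Suc_atMost)

lemma word_hd: "ss \<noteq> [] \<Longrightarrow> hd ss \<noteq> 1 \<Longrightarrow> hd ss \<noteq> 0 \<Longrightarrow> word True ss \<noteq> [] \<and> hd (word True ss) \<noteq> P"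
proof (cases ss)
  case (Cons s tt)
  assume "hd ss \<noteq> 1" "hd ss \<noteq> 0"
  then show ?thesis using Cons by (cases "nat \<bar>s\<bar> - 1") auto
qed auto

lemma S_tendsto_Z:
  assumes "ss \<noteq> []" "hd ss \<noteq> 1" "0 \<notin> set ss"
  shows "S ss \<longlonglongrightarrow> Z (word True ss)"
proof -
  have "hd ss \<noteq> 0" using assms by (metis hd_in_set)
  then have "summable (cf (word True ss))"
    using word_hd[of ss] assms by (intro cf_convergence(1)) auto
  from LIMSEQ_Suc[OF summable_LIMSEQ[OF this]]
  show ?thesis unfolding Z_def S_conv_partial_sum[OF assms(3), abs_def] .
qed

lemma stuffle_hd:
  assumes "w \<in> set (stuffle u v)" "u \<noteq> []" "v \<noteq> []"
  shows "w \<noteq> [] \<and> hd w \<in> {hd u, hd v, bar_plus (hd u) (hd v)}"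
  using assms by (cases u; cases v) auto

lemma bar_plus_neq: "s \<noteq> 0 \<Longrightarrow> t \<noteq> 0 \<Longrightarrow> bar_plus s t \<noteq> 0 \<and> bar_plus s t \<noteq> 1"
  by (auto simp: bar_plus_def sgn_if)

lemma stuffle_nonzero: "w \<in> set (stuffle u v) \<Longrightarrow> 0 \<notin> set u \<Longrightarrow> 0 \<notin> set v \<Longrightarrow> 0 \<notin> set w"
proof (induction u v arbitrary: w rule: stuffle.induct)
  case (3 s u t v)
  then show ?case using bar_plus_neq[of s t] by auto
qed auto

lemma Z_stuffle:
  assumes "u \<noteq> []" "hd u \<noteq> 1" "0 \<notin> set u" "v \<noteq> []" "hd v \<noteq> 1" "0 \<notin> set v"
  shows "Z (word True u) * Z (word True v) = (\<Sum>w\<leftarrow>stuffle u v. Z (word True w))"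
proof -
  have "hd u \<noteq> 0" "hd v \<noteq> 0" using assms by (metis hd_in_set)+
  then have "w \<noteq> [] \<and> hd w \<noteq> 1 \<and> 0 \<notin> set w" if "w \<in> set (stuffle u v)" for w
    using assms stuffle_hd[OF that] stuffle_nonzero[OF that] bar_plus_neq[of "hd u" "hd v"] by auto
  then have "(\<lambda>n. \<Sum>w\<leftarrow>stuffle u v. S w n) \<longlonglongrightarrow> (\<Sum>w\<leftarrow>stuffle u v. Z (word True w))"
    by (intro tendsto_sum_list S_tendsto_Z) auto
  moreover have "(\<lambda>n. S u n * S v n) \<longlonglongrightarrow> Z (word True u) * Z (word True v)"
    using assms by (intro tendsto_mult S_tendsto_Z)
  ultimately show ?thesis
    unfolding S_stuffle[OF assms(3,6)] by (rule LIMSEQ_unique[symmetric])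
qed

section \<open>Regularised product with the divergent word\<close>

lemma G_P: 
  assumes "0 \<le> x" "x < 1"
  shows "G [P] x = - ln (1 - x)"
proof (rule eq_if_deriv_eq[where f = "G [P]" and d = "\<lambda>x. 1 / (1 - x)"])
  show "(G [P] has_real_derivative 1 / (1 - x)) (at x)" if "0 < x" "x < 1" for x
    using G_deriv[OF that, of P "[]"] by simp
  show "((\<lambda>x. - ln (1 - x)) has_real_derivative 1 / (1 - x)) (at x)" if "0 < x" "x < 1" for x :: real
    using that by (auto intro!: derivative_eq_intros)
qed (use assms in \<open>auto intro!: continuous_on_G continuous_intros\<close>)

text \<open>
  By AM-GM \<open>1 / sqrt n \<le> \<delta> / 2 + 1 / (2 \<delta> n)\<close>, which reduces the tail estimate to the
  geometric and the logarithmic series; \<open>\<delta> = sqrt (1 - x)\<close> balances the two.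
\<close>

lemma G_rate:
  assumes "summable (cf w)" "\<And>N. N \<ge> 1 \<Longrightarrow> \<bar>Z w - (\<Sum>n<N. cf w n)\<bar> \<le> K * real N powr (-1/2)"
    and x: "0 < x" "x < 1"
  shows "\<bar>Z w - G w x\<bar> \<le> K * (sqrt (1 - x) * (1 / 2 + G [P] x / (2 * x)))"
proof -
  define e where "e n = Z w - (\<Sum>m<Suc n. cf w m)" for n
  define \<delta> where "\<delta> = sqrt (1 - x)"
  have \<delta>: "\<delta> > 0" "\<delta> * \<delta> = 1 - x" using x by (auto simp: \<delta>_def)
  have K: "K \<ge> 0" using assms(2)[of 1] by auto
  have e: "\<bar>e n\<bar> \<le> K * (\<delta> / 2 + 1 / (2 * \<delta> * real (Suc n)))" for n
  proof -
    define t where "t = real (Suc n) powr (-1/2)"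
    have t: "t * t = 1 / real (Suc n)" by (simp add: t_def powr_add[symmetric] powr_minus divide_simps)
    have "0 \<le> (\<delta> - t)\<^sup>2" by simp
    then have "2 * \<delta> * t \<le> \<delta> * \<delta> + 1 / real (Suc n)"
      using t by (simp add: power2_eq_square algebra_simps)
    then have "t \<le> (\<delta> * \<delta> + 1 / real (Suc n)) / (2 * \<delta>)"
      using \<delta>(1) by (simp add: pos_le_divide_eq mult_ac)
    also have "\<dots> = \<delta> / 2 + 1 / (2 * \<delta> * real (Suc n))"
      using \<delta>(1) by (simp add: add_divide_distrib mult_ac)
    finally have "t \<le> \<delta> / 2 + 1 / (2 * \<delta> * real (Suc n))" .
    then have "K * t \<le> K * (\<delta> / 2 + 1 / (2 * \<delta> * real (Suc n)))"
      using K by (rule mult_left_mono)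
    then show ?thesis using assms(2)[of "Suc n"] unfolding e_def t_def by simp
  qed
  have geo: "(\<lambda>n. x ^ n) sums (1 / (1 - x))" using x by (intro geometric_sums) auto
  have ser: "(\<lambda>n. x ^ n / real (Suc n)) sums (G [P] x / x)"
  proof -
    have "(\<lambda>n. cf [P] n * x ^ n) sums G [P] x"
      unfolding G_def using x by (intro summable_sums summable_G) auto
    then have "(\<lambda>n. cf [P] (Suc n) * x ^ Suc n) sums G [P] x"
      using sums_Suc_iff[of "\<lambda>n. cf [P] n * x ^ n"] by simp
    moreover have "cf [P] (Suc n) = 1 / real (Suc n)" for n
      by (simp add: sum.lessThan_Suc_shift del: sum.lessThan_Suc)
    ultimately have "(\<lambda>n. 1 / x * (1 / real (Suc n) * x ^ Suc n)) sums (1 / x * G [P] x)"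
      by (intro sums_mult) simp
    then show ?thesis using x by simp
  qed
  have "(\<lambda>n. K * (\<delta> / 2 * x ^ n + 1 / (2 * \<delta>) * (x ^ n / real (Suc n)))) sums
      (K * (\<delta> / 2 * (1 / (1 - x)) + 1 / (2 * \<delta>) * (G [P] x / x)))"
    by (intro sums_mult sums_add geo ser)
  note maj = this
  have le: "\<bar>e n * x ^ n\<bar> \<le> K * (\<delta> / 2 * x ^ n + 1 / (2 * \<delta>) * (x ^ n / real (Suc n)))" for n
  proof -
    have "\<bar>e n * x ^ n\<bar> \<le> K * (\<delta> / 2 + 1 / (2 * \<delta> * real (Suc n))) * x ^ n"
      using e[of n] x by (simp add: abs_mult mult_right_mono)
    then show ?thesis by (simp add: algebra_simps)
  qed
  have "summable (\<lambda>n. e n * x ^ n)"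
    by (rule summable_comparison_test'[OF sums_summable[OF maj]]) (use le in auto)
  then have se: "(\<lambda>n. e n * x ^ n) sums (\<Sum>n. e n * x ^ n)" by (rule summable_sums)
  have "(\<lambda>n. Z w * x ^ n - e n * x ^ n) sums (Z w * (1 / (1 - x)) - (\<Sum>n. e n * x ^ n))"
    by (intro sums_diff sums_mult geo se)
  \<comment> \<open>The partial sums are \<open>Z w - e n\<close>, so telescoping expresses
    \<open>Z w - G w x\<close> as \<open>1 - x\<close> times the power series of the tails
    \<open>e n\<close>.\<close>
  then have ps: "(\<lambda>n. (\<Sum>m<Suc n. cf w m) * x ^ n) sums (Z w * (1 / (1 - x)) - (\<Sum>n. e n * x ^ n))"
    by (simp add: e_def algebra_simps)
  from power_series_partial_sums[OF sums_summable[OF ps]] sums_unique[OF ps]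
  have "G w x = (1 - x) * (Z w * (1 / (1 - x)) - (\<Sum>n. e n * x ^ n))"
    by (simp add: G_def)
  also have "\<dots> = Z w - (1 - x) * (\<Sum>n. e n * x ^ n)" using x by (simp add: field_simps)
  finally have "\<bar>Z w - G w x\<bar> = (1 - x) * \<bar>\<Sum>n. e n * x ^ n\<bar>" using x by (simp add: abs_mult)
  also have "\<bar>\<Sum>n. e n * x ^ n\<bar> \<le> K * (\<delta> / 2 * (1 / (1 - x)) + 1 / (2 * \<delta>) * (G [P] x / x))"
    using norm_suminf_le[of "\<lambda>n. e n * x ^ n", OF _ sums_summable[OF maj]] le sums_unique[OF maj] by simp
  also have "(1 - x) * (K * (\<delta> / 2 * (1 / (1 - x)) + 1 / (2 * \<delta>) * (G [P] x / x))) =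
      K * (\<delta> * (1 / 2 + G [P] x / (2 * x)))"
    unfolding \<delta>(2)[symmetric] using \<delta>(1) x by (simp add: field_simps)
  finally show ?thesis using x by (simp add: \<delta>_def mult_left_mono)
qed

text \<open>The first factor is - ln (1 - x), and by \<open>G_rate\<close> the second is at most of
  the order of sqrt (1 - x) times a logarithm.\<close>

lemma G_P_mult_tendsto_0:
  assumes "w \<noteq> []" "hd w \<noteq> P"
  shows "((\<lambda>x. G [P] x * (Z w - G w x)) \<longlongrightarrow> 0) (at_left 1)"
proof -
  obtain K where K: "\<And>N. N \<ge> 1 \<Longrightarrow> \<bar>Z w - (\<Sum>n<N. cf w n)\<bar> \<le> K * real N powr (-1/2)"
    using cf_convergence(2)[OF assms] by blast
  show ?thesis
  proof (rule Lim_null_comparison)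
    show "\<forall>\<^sub>F x in at_left 1. norm (G [P] x * (Z w - G w x)) \<le>
        K * (- ln (1 - x) * (sqrt (1 - x) * (1 / 2 - ln (1 - x) / (2 * x))))"
      using eventually_at_left_1
    proof eventually_elim
      case (elim x)
      have "ln (1 - x) \<le> 0" using elim by simp
      then have "\<bar>ln (1 - x)\<bar> * \<bar>Z w - G w x\<bar> \<le>
          - ln (1 - x) * (K * (sqrt (1 - x) * (1 / 2 - ln (1 - x) / (2 * x))))"
        using G_rate[OF cf_convergence(1)[OF assms] K, of x] elim by (intro mult_mono) (auto simp: G_P)
      then show ?case using elim by (simp add: G_P abs_mult mult_ac)
    qed
    have "((\<lambda>x::real. - ln (1 - x) * (sqrt (1 - x) * (1 / 2 - ln (1 - x) / (2 * x)))) \<longlongrightarrow> 0) (at_left 1)"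
      by real_asymp
    then show "((\<lambda>x. K * (- ln (1 - x) * (sqrt (1 - x) * (1 / 2 - ln (1 - x) / (2 * x))))) \<longlongrightarrow> 0) (at_left 1)"
      by (rule tendsto_mult_right_zero)
  qed
qed

lemma S_1: "S [1] N = harm N"
  by (simp add: harm_def sg_def inverse_eq_divide)

lemma word_last: "0 \<notin> set ss \<Longrightarrow> ss \<noteq> [] \<Longrightarrow> last (word p ss) \<noteq> A"
proof (induction ss arbitrary: p)
  case (Cons s ss)
  then show ?case by (cases "ss = []") (auto simp: neq_Nil_conv)
qed auto

text \<open>
  Shuffle and stuffle product of the divergent word \<open>[P]\<close> with \<open>w\<close> have the single divergent
  term \<open>P # w\<close> in common, and it may be cancelled since both \<open>G [P] x * (Z w - G w x)\<close> and
  \<open>harm N * (Z w - S w N)\<close> tend to 0.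
\<close>

lemma Z_regularised:
  assumes "0 \<notin> set (s # ss)" "s \<noteq> 1"
  defines "w \<equiv> word True (s # ss)"
  shows "(\<Sum>v\<leftarrow>shuf [P] (tl w). Z (hd w # v)) =
    (\<Sum>t\<leftarrow>stuffle [1] ss. Z (word True (s # t))) + Z (word True (bar_plus 1 s # ss))"
    (is "?L = ?R")
proof -
  have w: "w \<noteq> []" "hd w \<noteq> P" "last w \<noteq> A"
    using word_hd[of "s # ss"] word_last[of "s # ss" True] assms by auto
  \<comment> \<open>Two series that may diverge, combined so that the divergence cancels. Their
    partial sums are evaluated by the stuffle product, their power series by the shuffle product,
    and Abel's theorem identifies the results.\<close>
  define r where "r n = Z w * cf [P] n - cf (P # w) n" for n
  have sS: "S (s # ss) N = (\<Sum>m<Suc N. cf w m)" for N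
    unfolding w_def by (rule S_conv_partial_sum) (use assms in auto)
  obtain K where K: "\<And>N. N \<ge> 1 \<Longrightarrow> \<bar>Z w - (\<Sum>n<N. cf w n)\<bar> \<le> K * real N powr (-1/2)"
    using cf_convergence(2)[OF w(1,2)] by blast
  obtain C where C: "C > 0" "\<And>n. n \<ge> 1 \<Longrightarrow> (1 + harm n :: real) ^ 1 \<le> C * real n powr (1/4)"
    using harm_power_le_root by blast
  \<comment> \<open>Here the rate is needed: logarithmic growth, bounded by N^(1/4), against an
    error of order N^(-1/2).\<close>
  have lim0: "(\<lambda>N. harm N * (Z w - S (s # ss) N)) \<longlonglongrightarrow> 0"
  proof (rule Lim_null_comparison)
    show "\<forall>\<^sub>F N in sequentially. norm (harm N * (Z w - S (s # ss) N)) \<le> C * K * real N powr (-1/4)"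
    proof (rule eventually_sequentiallyI[of 1])
      fix N :: nat assume N: "1 \<le> N"
      have K0: "K \<ge> 0" using K[of 1] by auto
      have "\<bar>Z w - S (s # ss) N\<bar> \<le> K * real (Suc N) powr (-1/2)" unfolding sS by (rule K) simp
      also have "\<dots> \<le> K * real N powr (-1/2)"
        using N K0 by (intro mult_left_mono powr_mono2') auto
      finally have "norm (harm N * (Z w - S (s # ss) N)) \<le>
          (C * real N powr (1/4)) * (K * real N powr (-1/2))"
        unfolding norm_mult using C(2)[OF N] C(1) by (intro mult_mono) (auto simp: norm_harm)
      also have "\<dots> = C * K * (real N powr (1/4) * real N powr (-1/2))" by simp
      also have "real N powr (1/4) * real N powr (-1/2) = real N powr (-1/4)"
        by (simp only: powr_add[symmetric]) simp
      finally show "norm (harm N * (Z w - S (s # ss) N)) \<le> C * K * real N powr (-1/4)" .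
    qed
    show "(\<lambda>N. C * K * real N powr (-1/4)) \<longlonglongrightarrow> 0"
      by (intro tendsto_mult_right_zero tendsto_neg_powr filterlim_real_sequentially) auto
  qed
  have "harm N * S (s # ss) N - S (1 # s # ss) N =
      (\<Sum>t\<leftarrow>stuffle [1] ss. S (s # t) N) + S (bar_plus 1 s # ss) N" for N
    using S_stuffle[of "[1]" "s # ss" N] assms by (simp add: S_1[symmetric] o_def del: S.simps)
  moreover have "S (s # t) \<longlonglongrightarrow> Z (word True (s # t))" if "t \<in> set (stuffle [1] ss)" for t
    using stuffle_nonzero[OF that] assms by (intro S_tendsto_Z) auto
  moreover have "S (bar_plus 1 s # ss) \<longlonglongrightarrow> Z (word True (bar_plus 1 s # ss))"
    using bar_plus_neq[of 1 s] assms by (intro S_tendsto_Z) auto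
  ultimately have limS: "(\<lambda>N. harm N * S (s # ss) N - S (1 # s # ss) N) \<longlonglongrightarrow> ?R"
    by (simp only:) (intro tendsto_add tendsto_sum_list)
  have "(\<Sum>n<Suc N. r n) = harm N * (Z w - S (s # ss) N) + (harm N * S (s # ss) N - S (1 # s # ss) N)" for N
  proof -
    have "(\<Sum>n<Suc N. r n) = Z w * (\<Sum>n<Suc N. cf (word True [1]) n) - (\<Sum>n<Suc N. cf (word True (1 # s # ss)) n)"
    proof -
      have "word True [1] = [P]" "word True (1 # s # ss) = P # w" by (simp_all add: w_def)
      then show ?thesis by (simp only: r_def sum_subtractf sum_distrib_left)
    qed
    also have "\<dots> = Z w * harm N - S (1 # s # ss) N"
      by (subst (1 2) S_conv_partial_sum[symmetric]) (use assms in \<open>auto simp: S_1 simp del: S.simps\<close>)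
    finally show ?thesis by (simp add: algebra_simps del: S.simps)
  qed
  with tendsto_add[OF lim0 limS] have "(\<lambda>N. \<Sum>n<Suc N. r n) \<longlonglongrightarrow> ?R" by simp
  then have r: "r sums ?R" unfolding sums_def by (subst (asm) filterlim_sequentially_Suc)
  have "((\<lambda>x. \<Sum>n. r n * x ^ n) \<longlongrightarrow> ?R) (at_left 1)"
    using Abel_limit[OF sums_summable[OF r]] sums_unique[OF r] by simp
  \<comment> \<open>This replaces the constant \<open>Z w\<close> by \<open>G w x\<close>, which
    makes the shuffle product with \<open>[P]\<close> applicable at every x below 1.\<close>
  from tendsto_diff[OF this G_P_mult_tendsto_0[OF w(1,2)]]
  have "((\<lambda>x. (\<Sum>n. r n * x ^ n) - G [P] x * (Z w - G w x)) \<longlongrightarrow> ?R) (at_left 1)" by simp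
  moreover have "\<forall>\<^sub>F x in at_left 1. (\<Sum>n. r n * x ^ n) - G [P] x * (Z w - G w x) =
      (\<Sum>v\<leftarrow>shuf [P] (tl w). G (hd w # v) x)"
    using eventually_at_left_1
  proof eventually_elim
    case (elim x)
    then have x: "\<bar>x\<bar> < 1" by auto
    have "(\<lambda>n. Z w * (cf [P] n * x ^ n) - cf (P # w) n * x ^ n) sums (Z w * G [P] x - G (P # w) x)"
      unfolding G_def by (intro sums_diff sums_mult summable_sums summable_G x)
    then have "(\<Sum>n. r n * x ^ n) = Z w * G [P] x - G (P # w) x"
      by (simp add: r_def sums_iff algebra_simps)
    moreover have "G [P] x * G w x = G (P # w) x + (\<Sum>v\<leftarrow>shuf [P] (tl w). G (hd w # v) x)"
      using G_shuffle[of "[P]" w x] w elim by (cases w) (auto simp: o_def)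
    ultimately show ?case by (simp add: algebra_simps)
  qed
  ultimately have "((\<lambda>x. \<Sum>v\<leftarrow>shuf [P] (tl w). G (hd w # v) x) \<longlongrightarrow> ?R) (at_left 1)"
    by (rule Lim_transform_eventually)
  moreover have "((\<lambda>x. \<Sum>v\<leftarrow>shuf [P] (tl w). G (hd w # v) x) \<longlongrightarrow> ?L) (at_left 1)"
    using w by (intro tendsto_sum_list G_tendsto_Z cf_convergence(1)) auto
  ultimately show ?thesis
    using tendsto_unique[OF trivial_limit_at_left_real] by blast
qed

subsection \<open>Constants\<close>

lemma Z_M: "Z [M] = - ln 2"
proof -
  have "(\<lambda>n. cf [M] (Suc n)) sums (- ln 2)"
  proof -
    have "cf [M] (Suc n) = - ((-1) ^ n / real (Suc n))" for n
      by (simp add: sum.lessThan_Suc_shift del: sum.lessThan_Suc)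
    then show ?thesis using sums_minus[OF alternating_harmonic_series_sums] by simp
  qed
  then have "cf [M] sums (- ln 2)" using sums_Suc_iff[of "cf [M]"] by simp
  then show ?thesis unfolding Z_def by (rule sums_unique[symmetric])
qed

lemma cf_zeta_word:
  "k \<ge> 1 \<Longrightarrow> cf (replicate (k - 1) A @ [P]) (Suc n) = 1 / real (Suc n) ^ k"
  by (cases k) (auto simp: cf_replicate_A sum.lessThan_Suc_shift simp del: sum.lessThan_Suc)

lemma Z_zeta:
  assumes "k \<ge> 2"
  shows "Z (replicate (k - 1) A @ [P]) = zeta k"
proof -
  have "summable (cf (replicate (k - 1) A @ [P]))"
    using assms by (intro cf_convergence) (auto simp: hd_append)
  from suminf_split_head[OF this]
  have "Z (replicate (k - 1) A @ [P]) = (\<Sum>n. cf (replicate (k - 1) A @ [P]) (Suc n))"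
    by (simp add: Z_def)
  moreover have "cf (replicate (k - 1) A @ [P]) (Suc n) = 1 / real (Suc n) ^ k" for n
    using assms by (intro cf_zeta_word) simp
  ultimately show ?thesis by (simp only: zeta_def)
qed

text \<open>The polylogarithm is the iterated integral of one \<open>P\<close> followed outwards by
  k - 1 letters \<open>A\<close>; the substitution moves its argument 1/2 to 1.\<close>

lemma polylog_half:
  assumes "k \<ge> 1"
  shows "polylog k (1 / 2) = lsum Z (subst landen_subst (replicate (k - 1) A @ [P]))"
proof -
  let ?w = "replicate (k - 1) A @ [P]"
  have "summable (\<lambda>n. cf ?w n * (1 / 2) ^ n)" by (rule summable_G) simp
  from suminf_split_head[OF this]
  have "G ?w (1 / 2) = (\<Sum>n. (1 / 2) ^ Suc n * cf ?w (Suc n))"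
    by (simp add: G_def mult.commute)
  then have "G ?w (1 / 2) = polylog k (1 / 2)"
    unfolding cf_zeta_word[OF assms] polylog_def by simp
  moreover have "set ?w \<subseteq> {A, P}" by auto
  ultimately show ?thesis using G_half_landen[of ?w] by simp
qed

subsection \<open>Gaussian elimination up to weight four\<close>

text \<open>
  Each relation, after substituting the preceding equations, is solved for one word that is
  then eliminated from all later relations.
\<close>

lemma replicate_numeral: "replicate (numeral k) x = x # replicate (pred_numeral k) x"
  by (simp add: numeral_eq_Suc)

context
  notes [simp] = admissible_def bar_plus_def replicate_numeral Z_M algebra_simps power_numeral_reduce
begin

text \<open>Values of words count as unknowns. Products of values of lower weight are already
  evaluated, so each relation becomes a linear equation in the unknowns of the present
  weight.\<close>

lemma weight_2_values [simp]:
  "Z [M,M] = 1/2 * ln 2 ^ 2"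
  "Z [M,P] = - 1/2 * zeta 2 + 1/2 * ln 2 ^ 2"
  "Z [A,M] = - 1/2 * zeta 2"
  "Z [A,P] = zeta 2"
proof -
  have [simp]: "Z [A,M] = - 1/2 * Z [A,P]"
    by ((simp (no_asm))?, (use Z_doubling[of "[P]", simplified] in linarith))
  have [simp]: "Z [M,P] = - 1/2 * Z [A,P] + 1/2 * ln 2 ^ 2"
    by ((simp (no_asm))?, (use Z_stuffle[of "[-1]" "[-1]", simplified] in linarith))
  have [simp]: "Z [A,P] = zeta 2"
    by ((simp (no_asm))?, (use Z_zeta[of 2, simplified] in linarith))
  have [simp]: "Z [M,M] = 1/2 * ln 2 ^ 2"
    by ((simp (no_asm))?, (use Z_shuffle[of "[M]" "[M]", simplified] in linarith))
  show "Z [M,M] = 1/2 * ln 2 ^ 2"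
    "Z [M,P] = - 1/2 * zeta 2 + 1/2 * ln 2 ^ 2"
    "Z [A,M] = - 1/2 * zeta 2"
    "Z [A,P] = zeta 2"
    by (simp; linarith)+
qed

lemma weight_3_values [simp]:
  "Z [M,M,M] = - 1/6 * ln 2 ^ 3"
  "Z [M,M,P] = 1/8 * zeta 3 - 1/6 * ln 2 ^ 3"
  "Z [M,A,M] = - 1/4 * zeta 3 + 1/2 * zeta 2 * ln 2"
  "Z [M,A,P] = 5/8 * zeta 3 - zeta 2 * ln 2"
  "Z [A,M,M] = 1/8 * zeta 3"
  "Z [A,M,P] = - 13/8 * zeta 3 + 3/2 * zeta 2 * ln 2"
  "Z [A,A,M] = - 3/4 * zeta 3"
  "Z [A,A,P] = zeta 3"
  "Z [A,P,M] = zeta 3 - 3/2 * zeta 2 * ln 2"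
  "Z [A,P,P] = zeta 3"
proof -
  have [simp]: "Z [M,M,P] = - 1/2 * Z [M,P,M] + 1/4 * zeta 2 * ln 2 - 1/4 * ln 2 ^ 3"
    by ((simp (no_asm))?, (use Z_shuffle[of "[M]" "[M,P]", simplified] in linarith))
  have [simp]: "Z [M,M,M] = - 1/6 * ln 2 ^ 3"
    by ((simp (no_asm))?, (use Z_shuffle[of "[M]" "[M,M]", simplified] in linarith))
  have [simp]: "Z [M,P,M] = - 1/3 * Z [M,A,M] - 1/3 * Z [A,P,M] + 1/6 * zeta 2 * ln 2 - 1/6 * ln 2 ^ 3"
    by ((simp (no_asm))?, (use Z_stuffle[of "[-1]" "[-1,-1]", simplified] in linarith))
  have [simp]: "Z [A,P,P] = Z [A,A,P]"
    by ((simp (no_asm))?, (use Z_regularised[of "2" "[]", simplified] in linarith))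
  have [simp]: "Z [A,A,M] = - 3/4 * Z [A,A,P]"
    by ((simp (no_asm))?, (use Z_doubling[of "[A,P]", simplified] in linarith))
  have [simp]: "Z [M,A,M] = - 2 * Z [A,M,M] + 1/2 * zeta 2 * ln 2"
    by ((simp (no_asm))?, (use Z_shuffle[of "[M]" "[A,M]", simplified] in linarith))
  have [simp]: "Z [A,M,M] = 1/2 * Z [A,P,M] - 3/8 * Z [A,A,P] + 3/4 * zeta 2 * ln 2"
    by ((simp (no_asm))?, (use Z_stuffle[of "[-1]" "[2]", simplified] in linarith))
  have [simp]: "Z [M,A,P] = - Z [A,M,P] - Z [A,P,M] - zeta 2 * ln 2"
    by ((simp (no_asm))?, (use Z_shuffle[of "[M]" "[A,P]", simplified] in linarith))
  have [simp]: "Z [A,M,P] = - 1/2 * Z [A,P,M] - 9/8 * Z [A,A,P] + 3/4 * zeta 2 * ln 2"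
    by ((simp (no_asm))?, (use Z_regularised[of "-2" "[]", simplified] in linarith))
  have [simp]: "Z [A,P,M] = Z [A,A,P] - 3/2 * zeta 2 * ln 2"
    by ((simp (no_asm))?, (use Z_stuffle[of "[-1]" "[-2]", simplified] in linarith))
  have [simp]: "Z [A,A,P] = zeta 3"
    by ((simp (no_asm))?, (use Z_zeta[of 3, simplified] in linarith))
  show "Z [M,M,M] = - 1/6 * ln 2 ^ 3"
    "Z [M,M,P] = 1/8 * zeta 3 - 1/6 * ln 2 ^ 3"
    "Z [M,A,M] = - 1/4 * zeta 3 + 1/2 * zeta 2 * ln 2"
    "Z [M,A,P] = 5/8 * zeta 3 - zeta 2 * ln 2"
    "Z [A,M,M] = 1/8 * zeta 3"
    "Z [A,M,P] = - 13/8 * zeta 3 + 3/2 * zeta 2 * ln 2"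
    "Z [A,A,M] = - 3/4 * zeta 3"
    "Z [A,A,P] = zeta 3"
    "Z [A,P,M] = zeta 3 - 3/2 * zeta 2 * ln 2"
    "Z [A,P,P] = zeta 3"
    by (simp; linarith)+
qed

text \<open>The new constant is Li_4(1/2), brought in by \<open>polylog_half\<close>. Euler's
  relation between \<open>zeta 2\<close> squared and \<open>zeta 4\<close> is not presupposed: it
  follows from comparing the shuffle and stuffle squares of \<open>Z [A,P]\<close> with the
  regularised relation for the exponent 3.\<close>

lemma weight_4_values [simp]:
  "zeta 2 * zeta 2 = 5/2 * zeta 4"
  "Z [M,M,A,M] = 3 * polylog 4 (1/2) - 3 * zeta 4 + 23/8 * zeta 3 * ln 2 - zeta 2 * ln 2 ^ 2 + 1/8 * ln 2 ^ 4"
  "Z [M,A,A,M] = - 5/16 * zeta 4 + 3/4 * zeta 3 * ln 2"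
  "Z [M,P,A,P] = polylog 4 (1/2) - 19/16 * zeta 4 + 1/4 * zeta 3 * ln 2 + 1/4 * zeta 2 * ln 2 ^ 2 + 1/24 * ln 2 ^ 4"
  "Z [A,M,M,P] = 2 * polylog 4 (1/2) - 9/8 * zeta 4 + 1/4 * zeta 2 * ln 2 ^ 2 + 1/12 * ln 2 ^ 4"
  "Z [A,M,A,M] = - 4 * polylog 4 (1/2) + 65/16 * zeta 4 - 7/2 * zeta 3 * ln 2 + zeta 2 * ln 2 ^ 2 - 1/6 * ln 2 ^ 4"
  "Z [A,M,P,M] = - 7/8 * zeta 4 + 21/8 * zeta 3 * ln 2 - 3/2 * zeta 2 * ln 2 ^ 2"
  "Z [A,A,A,M] = - 7/8 * zeta 4"
  "Z [A,A,A,P] = zeta 4"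
  "Z [A,A,P,M] = 19/16 * zeta 4 - 7/4 * zeta 3 * ln 2"
  "Z [A,P,A,M] = 4 * polylog 4 (1/2) - 71/16 * zeta 4 + 7/2 * zeta 3 * ln 2 - zeta 2 * ln 2 ^ 2 + 1/6 * ln 2 ^ 4"
proof -
  have [simp]: "Z [M,P,A,P] = - 1/2 * Z [M,A,M,P] - 1/2 * Z [M,A,A,P] - 1/2 * Z [A,P,A,P] + 1/8 * zeta 3 * ln 2 - 1/4 * zeta 2 * ln 2 ^ 2"
    by ((simp (no_asm))?, (use Z_stuffle[of "[-1]" "[-1,2]", simplified] in linarith))
  have [simp]: "Z [A,P,A,M] = - Z [A,M,A,M] - Z [A,A,A,M] - 1/2 * zeta 2 * zeta 2"
    by ((simp (no_asm))?, (use Z_stuffle[of "[-2]" "[2]", simplified] in linarith))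
  have [simp]: "Z [M,A,A,P] = - Z [A,A,M,P] - Z [A,A,A,P] + 3/4 * zeta 3 * ln 2"
    by ((simp (no_asm))?, (use Z_stuffle[of "[-1]" "[-3]", simplified] in linarith))
  have [simp]: "Z [A,A,M,P] = - 3/4 * Z [A,A,P,P] - Z [A,A,P,M] - Z [A,A,M,M]"
    by ((simp (no_asm))?, (use Z_doubling[of "[A,P,P]", simplified] in linarith))
  have [simp]: "Z [A,A,P,P] = - 1/2 * Z [A,P,A,P] + 1/4 * zeta 2 * zeta 2"
    by ((simp (no_asm))?, (use Z_shuffle[of "[A,P]" "[A,P]", simplified] in linarith))
  have [simp]: "Z [M,M,M,M] = 1/24 * ln 2 ^ 4"
    by ((simp (no_asm))?, (use Z_shuffle[of "[M,M]" "[M,M]", simplified] in linarith))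
  have [simp]: "Z [A,P,A,P] = 2 * Z [A,A,A,P] - 1/2 * zeta 2 * zeta 2"
    by ((simp (no_asm))?, (use Z_regularised[of "3" "[]", simplified] in linarith))
  have [simp]: "Z [A,A,A,M] = - 7/8 * Z [A,A,A,P]"
    by ((simp (no_asm))?, (use Z_doubling[of "[A,A,P]", simplified] in linarith))
  have [simp]: "Z [A,A,P,M] = - Z [M,A,A,M] + 7/8 * Z [A,A,A,P] - zeta 3 * ln 2"
    by ((simp (no_asm))?, (use Z_stuffle[of "[-1]" "[3]", simplified] in linarith))
  have [simp]: "Z [A,A,A,P] = 2/5 * zeta 2 * zeta 2"
    by ((simp (no_asm))?, (use Z_stuffle[of "[2]" "[2]", simplified] in linarith))
  have [simp]: "Z [A,M,M,M] = - 1/3 * Z [M,A,M,M] - 1/24 * zeta 3 * ln 2"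
    by ((simp (no_asm))?, (use Z_shuffle[of "[M]" "[A,M,M]", simplified] in linarith))
  have [simp]: "Z [A,P,M,M] = - Z [M,M,A,M] - Z [M,A,M,M] - Z [M,A,A,M] - Z [A,A,M,M] + 1/2 * zeta 2 * ln 2 ^ 2"
    by ((simp (no_asm))?, (use Z_stuffle[of "[-1,1]" "[2]", simplified] in linarith))
  have [simp]: "Z [A,A,M,M] = - 1/2 * Z [A,M,A,M] + 1/16 * zeta 2 * zeta 2"
    by ((simp (no_asm))?, (use Z_shuffle[of "[A,M]" "[A,M]", simplified] in linarith))
  have [simp]: "Z [A,M,A,M] = Z [M,P,A,M] + Z [M,A,P,M] + Z [M,A,M,P] - Z [M,M,A,M] - Z [M,A,M,M] - Z [M,A,A,M]"
    by ((simp (no_asm))?, (use Z_regularised[of "-1" "[2]", simplified] in linarith))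
  have [simp]: "Z [M,A,A,M] = - 1/8 * zeta 2 * zeta 2 + 3/4 * zeta 3 * ln 2"
    by ((simp (no_asm))?, (use Z_shuffle[of "[M]" "[A,A,M]", simplified] in linarith))
  have [simp]: "Z [M,M,A,M] = - Z [M,A,M,M] + 1/8 * zeta 3 * ln 2 - 1/4 * zeta 2 * ln 2 ^ 2"
    by ((simp (no_asm))?, (use Z_shuffle[of "[M]" "[M,A,M]", simplified] in linarith))
  have [simp]: "Z [M,A,M,M] = - 3/2 * Z [A,M,P,M] - 3/2 * Z [A,M,M,P] + 19/16 * zeta 3 * ln 2 - 9/8 * zeta 2 * ln 2 ^ 2"
    by ((simp (no_asm))?, (use Z_regularised[of "-2" "[1]", simplified] in linarith))
  have [simp]: "Z [M,A,M,P] = - 2 * Z [A,M,M,P] - Z [A,M,P,M] + 13/8 * zeta 3 * ln 2 - 3/2 * zeta 2 * ln 2 ^ 2"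
    by ((simp (no_asm))?, (use Z_shuffle[of "[M]" "[A,M,P]", simplified] in linarith))
  have [simp]: "Z [A,M,M,P] = - 7/10 * zeta 2 * zeta 2 + Z [M,P,A,M] + Z [M,A,P,M] + 2 * polylog 4 (1/2) + 13/8 * zeta 3 * ln 2 - zeta 2 * ln 2 ^ 2 + 1/12 * ln 2 ^ 4"
    by ((simp (no_asm))?, (use polylog_half[of 4, simplified] in linarith))
  have [simp]: "Z [A,M,P,M] = - Z [M,P,A,M] - Z [M,A,P,M] - 1/10 * zeta 2 * zeta 2 + zeta 3 * ln 2 - 1/4 * zeta 2 * ln 2 ^ 2"
    by ((simp (no_asm))?, (use Z_stuffle[of "[-1,-1]" "[-2]", simplified] in linarith))
  have [simp]: "Z [M,P,A,M] = - Z [M,A,P,M] + 1/4 * zeta 2 * zeta 2 - 13/8 * zeta 3 * ln 2 + 5/4 * zeta 2 * ln 2 ^ 2"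
    by ((simp (no_asm))?, (use Z_shuffle[of "[M,P]" "[A,M]", simplified] in linarith))
  \<comment> \<open>The value of \<open>Z [A,A,A,P]\<close> is by now 2/5 of the square of
    \<open>zeta 2\<close>; from here on the square is eliminated in favour of
    \<open>zeta 4\<close>.\<close>
  have [simp]: "zeta 2 * zeta 2 = 5/2 * zeta 4"
    by ((simp (no_asm))?, (use Z_zeta[of 4, simplified] in linarith))
  then have [simp]: "zeta 2 * (zeta 2 * x) = 5/2 * (zeta 4 * x)" for x
    by (simp only: mult.assoc [symmetric])
  show "zeta 2 * zeta 2 = 5/2 * zeta 4"
    "Z [M,M,A,M] = 3 * polylog 4 (1/2) - 3 * zeta 4 + 23/8 * zeta 3 * ln 2 - zeta 2 * ln 2 ^ 2 + 1/8 * ln 2 ^ 4"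
    "Z [M,A,A,M] = - 5/16 * zeta 4 + 3/4 * zeta 3 * ln 2"
    "Z [M,P,A,P] = polylog 4 (1/2) - 19/16 * zeta 4 + 1/4 * zeta 3 * ln 2 + 1/4 * zeta 2 * ln 2 ^ 2 + 1/24 * ln 2 ^ 4"
    "Z [A,M,M,P] = 2 * polylog 4 (1/2) - 9/8 * zeta 4 + 1/4 * zeta 2 * ln 2 ^ 2 + 1/12 * ln 2 ^ 4"
    "Z [A,M,A,M] = - 4 * polylog 4 (1/2) + 65/16 * zeta 4 - 7/2 * zeta 3 * ln 2 + zeta 2 * ln 2 ^ 2 - 1/6 * ln 2 ^ 4"
    "Z [A,M,P,M] = - 7/8 * zeta 4 + 21/8 * zeta 3 * ln 2 - 3/2 * zeta 2 * ln 2 ^ 2"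
    "Z [A,A,A,M] = - 7/8 * zeta 4"
    "Z [A,A,A,P] = zeta 4"
    "Z [A,A,P,M] = 19/16 * zeta 4 - 7/4 * zeta 3 * ln 2"
    "Z [A,P,A,M] = 4 * polylog 4 (1/2) - 71/16 * zeta 4 + 7/2 * zeta 3 * ln 2 - zeta 2 * ln 2 ^ 2 + 1/6 * ln 2 ^ 4"
    by (simp; linarith)+
qed

text \<open>In weight five the square is multiplied by \<open>ln 2\<close>, and in the normal form,
  nested to the right, it is no longer a subterm.\<close>

lemma zeta_2_mult_zeta_2_mult [simp]: "zeta 2 * (zeta 2 * x) = 5/2 * (zeta 4 * x)"
  by (simp only: mult.assoc [symmetric] weight_4_values(1))

end

subsection \<open>Euler sums\<close>

fun stuffle_all :: "int list \<Rightarrow> int list list" where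
  "stuffle_all [] = [[]]"
| "stuffle_all (s # ss) = concat (map (stuffle [s]) (stuffle_all ss))"

lemma stuffle_all_nonzero: "w \<in> set (stuffle_all ss) \<Longrightarrow> 0 \<notin> set ss \<Longrightarrow> 0 \<notin> set w"
proof (induction ss arbitrary: w)
  case (Cons s ss)
  then show ?case using stuffle_nonzero[of w "[s]"] by auto
qed auto

lemma stuffle_all_nonempty: "w \<in> set (stuffle_all ss) \<Longrightarrow> ss \<noteq> [] \<Longrightarrow> w \<noteq> []"
proof (cases ss)
  case (Cons s tt)
  assume "w \<in> set (stuffle_all ss)"
  then obtain v where "w \<in> set (stuffle [s] v)" using Cons by auto
  then show "w \<noteq> []" by (cases v) auto
qed auto

lemma prod_S: "0 \<notin> set ss \<Longrightarrow> (\<Prod>s\<leftarrow>ss. S [s] n) = (\<Sum>w\<leftarrow>stuffle_all ss. S w n)"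
proof (induction ss)
  case (Cons s ss)
  have "S [s] n * (\<Sum>w\<leftarrow>ws. S w n) = (\<Sum>w\<leftarrow>concat (map (stuffle [s]) ws). S w n)"
    if "\<And>w. w \<in> set ws \<Longrightarrow> 0 \<notin> set w" for ws
    using that
  proof (induction ws)
    case (Cons w ws)
    then show ?case
      using S_stuffle[of "[s]" w n] Cons.prems \<open>0 \<notin> set (s # ss)\<close>
      by (simp add: distrib_left del: S.simps)
  qed simp
  from this[of "stuffle_all ss"] show ?case
    using Cons stuffle_all_nonzero by (auto simp del: S.simps)
qed simp

text \<open>The limit of the sum over n of the summand encoded by \<open>p\<close> times the product
  of the sums \<open>S [s] n\<close>. These include the index n, whereas nested sums have strictly
  decreasing indices: the first value collects the smaller indices, the second the case that the
  outermost index equals n.\<close>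

definition euler_value :: "int \<Rightarrow> int list \<Rightarrow> real" where
  "euler_value p ss =
    (\<Sum>w\<leftarrow>stuffle_all ss. Z (word True (p # w)) + Z (word True (bar_plus p (hd w) # tl w)))"

lemma weighted_sum_S:
  assumes "p \<noteq> 0" "b \<noteq> 0"
  shows "(\<Sum>n=1..N. sg p ^ n / real n ^ nat \<bar>p\<bar> * S (b # w) n) =
    S (p # b # w) N + S (bar_plus p b # w) N"
proof (induction N)
  case (Suc N)
  have "sg p ^ Suc N / real (Suc N) ^ nat \<bar>p\<bar> * S (b # w) (Suc N) =
      sg p ^ Suc N / real (Suc N) ^ nat \<bar>p\<bar> * S (b # w) N +
      sg (bar_plus p b) ^ Suc N / real (Suc N) ^ nat \<bar>bar_plus p b\<bar> * S w N"
    unfolding sg_bar_plus[OF assms] S_Cons_Suc[of b] by (simp only: distrib_left mult.assoc)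
  moreover have "(\<Sum>n=1..Suc N. sg p ^ n / real n ^ nat \<bar>p\<bar> * S (b # w) n) =
      (\<Sum>n=1..N. sg p ^ n / real n ^ nat \<bar>p\<bar> * S (b # w) n) +
      sg p ^ Suc N / real (Suc N) ^ nat \<bar>p\<bar> * S (b # w) (Suc N)"
    by (subst sum.nat_ivl_Suc', simp, rule add.commute)
  ultimately show ?case
    unfolding S_Cons_Suc[of p] S_Cons_Suc[of "bar_plus p b"] Suc by linarith
qed simp

text \<open>The factor \<open>c\<close> reconciles the sign (-1)^(n-1) customary in Euler sums with
  the (-1)^n used by \<open>S\<close>.\<close>

lemma euler_sum_tendsto:
  assumes "p \<noteq> 0" "p \<noteq> 1" "0 \<notin> set ss" "ss \<noteq> []"
    and f: "\<And>n. n \<ge> 1 \<Longrightarrow> f n = c * (sg p ^ n / real n ^ nat \<bar>p\<bar> * (\<Prod>s\<leftarrow>ss. S [s] n))"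
  shows "(\<lambda>N. \<Sum>n=1..N. f n) \<longlonglongrightarrow> c * euler_value p ss"
proof -
  have w: "w \<noteq> [] \<and> 0 \<notin> set w \<and> hd w \<noteq> 0 \<and> 0 \<notin> set (tl w)" if "w \<in> set (stuffle_all ss)" for w
    using stuffle_all_nonzero[OF that] stuffle_all_nonempty[OF that] assms
    by (metis hd_in_set list.set_sel(2))
  have summand: "(\<Sum>n=1..N. sg p ^ n / real n ^ nat \<bar>p\<bar> * S w n) =
      S (p # w) N + S (bar_plus p (hd w) # tl w) N" if "w \<in> set (stuffle_all ss)" for w N
    using w[OF that] weighted_sum_S[OF assms(1), of "hd w" "tl w" N] by (simp del: S.simps)
  have *: "(\<Sum>n=1..N. x n * (\<Sum>w\<leftarrow>ws. g w n)) = (\<Sum>w\<leftarrow>ws. \<Sum>n=1..N. x n * g w n)"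
    for x :: "nat \<Rightarrow> real" and g :: "int list \<Rightarrow> nat \<Rightarrow> real" and ws N
    by (induction ws) (auto simp: distrib_left sum.distrib)
  have "(\<Sum>n=1..N. f n) = c * (\<Sum>n=1..N. sg p ^ n / real n ^ nat \<bar>p\<bar> * (\<Sum>w\<leftarrow>stuffle_all ss. S w n))" for N
    unfolding sum_distrib_left prod_S[OF assms(3), symmetric] by (intro sum.cong f) auto
  also have "(\<Sum>n=1..N. sg p ^ n / real n ^ nat \<bar>p\<bar> * (\<Sum>w\<leftarrow>stuffle_all ss. S w n)) =
      (\<Sum>w\<leftarrow>stuffle_all ss. S (p # w) N + S (bar_plus p (hd w) # tl w) N)" for N
    unfolding * by (intro arg_cong[where f = sum_list] map_cong refl summand)
  finally have eq: "(\<Sum>n=1..N. f n) =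
      c * (\<Sum>w\<leftarrow>stuffle_all ss. S (p # w) N + S (bar_plus p (hd w) # tl w) N)" for N .
  show ?thesis
    unfolding eq euler_value_def
    using w bar_plus_neq[of p] assms(1-2)
    by (intro tendsto_mult_left tendsto_sum_list tendsto_add S_tendsto_Z) auto
qed

lemma gen_harm_conv_S: "p > 0 \<Longrightarrow> gen_harm p n = S [int p] n"
  by (simp add: gen_harm_def sg_def)

lemma alt_harm_conv_S: "p > 0 \<Longrightarrow> alt_harm p n = - S [- int p] n"
proof -
  have "(-1 :: real) ^ j = - ((-1) ^ (j - 1))" if "j \<ge> 1" for j :: nat
    using that by (cases j) auto
  then show "p > 0 \<Longrightarrow> alt_harm p n = - S [- int p] n"
    by (simp add: alt_harm_def sg_def flip: sum_negf)
qed

section \<open>Evaluation in weight five\<close>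

context
  notes [simp] = admissible_def bar_plus_def replicate_numeral Z_M algebra_simps power_numeral_reduce
begin

text \<open>Li_5(1/2) enters through the single relation given by \<open>polylog_half\<close>. Words
  such as \<open>Z [M,A,M,M,M]\<close> or \<open>Z [M,A,P,A,P]\<close> are never evaluated; their
  coefficients cancel in the eight combinations.\<close>

lemma weight_5_values:
  "euler_value (-2) [1,-2] =
    125/32 * zeta 5 - 13/8 * zeta 2 * zeta 3"
  "euler_value (-1) [2,-2] =
    75/64 * zeta 5 + 3/8 * zeta 2 * zeta 3 - 25/16 * zeta 4 * ln 2"
  "euler_value 2 [1,-2] =
    - 4 * polylog 5 (1/2) - 4 * polylog 4 (1/2) * ln 2 - 29/64 * zeta 5 + 5/4 * zeta 2 * zeta 3 - 7/4 * zeta 3 * ln 2 ^ 2 + 2/3 * zeta 2 * ln 2 ^ 3 - 2/15 * ln 2 ^ 5"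
  "euler_value (-1) [1,1,2] =
    2 * polylog 4 (1/2) * ln 2 - 3/8 * zeta 2 * zeta 3 - 7/8 * zeta 4 * ln 2 + 7/8 * zeta 3 * ln 2 ^ 2 - 1/3 * zeta 2 * ln 2 ^ 3 + 1/12 * ln 2 ^ 5"
  "euler_value 2 [2,-1] =
    8 * polylog 5 (1/2) + 4 * polylog 4 (1/2) * ln 2 - 27/4 * zeta 5 - 1/2 * zeta 2 * zeta 3 + 23/16 * zeta 4 * ln 2 - 1/3 * zeta 2 * ln 2 ^ 3 + 1/10 * ln 2 ^ 5"
  "euler_value (-1) [2,2] =
    - 16 * polylog 5 (1/2) - 8 * polylog 4 (1/2) * ln 2 + 259/16 * zeta 5 - 5/8 * zeta 2 * zeta 3 - 29/4 * zeta 4 * ln 2 + 2/3 * zeta 2 * ln 2 ^ 3 - 1/5 * ln 2 ^ 5"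
  "euler_value (-1) [-2,-2] =
    16 * polylog 5 (1/2) + 8 * polylog 4 (1/2) * ln 2 - 299/16 * zeta 5 + 1/4 * zeta 2 * zeta 3 + 39/4 * zeta 4 * ln 2 - 2/3 * zeta 2 * ln 2 ^ 3 + 1/5 * ln 2 ^ 5"
  "euler_value (-1) [1,1,1,1] =
    - 8 * polylog 5 (1/2) - 4 * polylog 4 (1/2) * ln 2 + 83/16 * zeta 5 + 11/8 * zeta 2 * zeta 3 - 11/4 * zeta 4 * ln 2 - 9/4 * zeta 3 * ln 2 ^ 2 + 4/3 * zeta 2 * ln 2 ^ 3 - 3/10 * ln 2 ^ 5"
proof -
  \<comment> \<open>The labelled equations still contain other words and are completed by the later
    back substitution; the unlabelled ones are already closed.\<close>
  have r1 [simp]: "Z [A,M,A,P,P] = - 1/2 * Z [A,M,M,A,P] - 1/2 * Z [A,M,A,A,P] - 1/2 * Z [A,A,A,P,P] - 1/32 * zeta 2 * zeta 3"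
    by ((simp (no_asm))?, (use Z_stuffle[of "[-2]" "[-2,1]", simplified] in linarith))
  have r2 [simp]: "Z [M,A,M,A,P] = - Z [A,M,P,A,P] - Z [M,A,P,A,P] - Z [M,A,A,A,P] - Z [A,A,P,A,P] + 1/8 * zeta 2 * zeta 3 - 5/8 * zeta 4 * ln 2"
    by ((simp (no_asm))?, (use Z_stuffle[of "[-2]" "[-1,2]", simplified] in linarith))
  have r3 [simp]: "Z [A,M,M,A,P] = - Z [A,P,A,M,M] - 2 * Z [A,A,P,M,M] - 2 * Z [A,A,M,P,M] - 2 * Z [A,A,M,M,P] - Z [A,M,A,P,M] - Z [A,M,A,M,P] + 1/8 * zeta 2 * zeta 3"
    by ((simp (no_asm))?, (use Z_shuffle[of "[A,P]" "[A,M,M]", simplified] in linarith))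
  have r4 [simp]: "Z [A,M,P,A,P] = - Z [A,P,A,M,P] - Z [A,M,A,M,P] - Z [A,M,A,A,P] - Z [A,A,A,M,P] - 13/8 * zeta 2 * zeta 3 + 15/4 * zeta 4 * ln 2"
    by ((simp (no_asm))?, (use Z_stuffle[of "[2]" "[-2,-1]", simplified] in linarith))
  have r5 [simp]: "Z [A,P,A,M,P] = - Z [A,P,P,A,M] - Z [A,P,A,P,M] + Z [A,P,A,M,M] + Z [A,P,A,A,M] + Z [A,A,P,A,M]"
    by ((simp (no_asm))?, (use Z_regularised[of "2" "[-2]", simplified] in linarith))
  have r6 [simp]: "Z [A,P,P,A,M] = - Z [A,M,A,M,M] - Z [A,P,A,M,M] - Z [A,P,A,A,M] - Z [A,A,A,M,M] - 1/2 * zeta 2 * zeta 3"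
    by ((simp (no_asm))?, (use Z_stuffle[of "[-2]" "[2,1]", simplified] in linarith))
  have [simp]: "Z [M,M,M,M,M] = - 1/120 * ln 2 ^ 5"
    by ((simp (no_asm))?, (use Z_shuffle[of "[M,M]" "[M,M,M]", simplified] in linarith))
  have r8 [simp]: "Z [A,P,A,A,P] = - Z [A,A,P,A,P] - Z [A,A,A,P,P] + Z [A,A,A,A,P]"
    by ((simp (no_asm))?, (use Z_regularised[of "4" "[]", simplified] in linarith))
  have r9 [simp]: "Z [A,A,A,P,P] = 2 * Z [A,A,A,A,P] - zeta 2 * zeta 3"
    by ((simp (no_asm))?, (use Z_stuffle[of "[2]" "[3]", simplified] in linarith))
  have r10 [simp]: "Z [A,A,A,A,P] = - 16/15 * Z [A,A,A,A,M]"
    by ((simp (no_asm))?, (use Z_doubling[of "[A,A,A,P]", simplified] in linarith))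
  have r11 [simp]: "Z [A,M,M,M,M] = - 1/6 * Z [M,M,A,M,M] - 1/2 * Z [M,A,M,M,M] + 1/96 * zeta 3 * ln 2 ^ 2"
    by ((simp (no_asm))?, (use Z_shuffle[of "[M,M]" "[A,M,M]", simplified] in linarith))
  have r12 [simp]: "Z [A,M,A,A,P] = - Z [A,A,M,A,P] + 16/15 * Z [A,A,A,A,M] + 3/8 * zeta 2 * zeta 3"
    by ((simp (no_asm))?, (use Z_stuffle[of "[-2]" "[-3]", simplified] in linarith))
  have r13 [simp]: "Z [A,M,P,M,M] = - 1/2 * Z [M,A,M,P,M] - Z [A,M,M,P,M] + 7/16 * zeta 4 * ln 2 - 21/16 * zeta 3 * ln 2 ^ 2 + 3/4 * zeta 2 * ln 2 ^ 3"
    by ((simp (no_asm))?, (use Z_shuffle[of "[M]" "[A,M,P,M]", simplified] in linarith))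
  have r14 [simp]: "Z [M,A,A,P,M] = - Z [A,M,A,P,M] - Z [A,A,M,P,M] - 2 * Z [A,A,P,M,M] - 19/16 * zeta 4 * ln 2 + 7/4 * zeta 3 * ln 2 ^ 2"
    by ((simp (no_asm))?, (use Z_shuffle[of "[M]" "[A,A,P,M]", simplified] in linarith))
  have r15 [simp]: "Z [A,A,M,A,P] = - Z [A,P,A,A,M] - 2 * Z [A,A,P,A,M] - 3 * Z [A,A,A,P,M] - 3 * Z [A,A,A,M,P] - 3/4 * zeta 2 * zeta 3"
    by ((simp (no_asm))?, (use Z_shuffle[of "[A,P]" "[A,A,M]", simplified] in linarith))
  have r16 [simp]: "Z [A,A,A,M,P] = - Z [A,A,A,P,M] - Z [A,A,A,M,M] + 28/15 * Z [A,A,A,A,M] + 7/8 * zeta 2 * zeta 3"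
    by ((simp (no_asm))?, (use Z_doubling[of "[A,A,P,P]", simplified] in linarith))
  have [simp]: "Z [A,A,A,A,M] = - 15/16 * zeta 5"
    by ((simp (no_asm))?, (use Z_zeta[of 5, simplified] in linarith))
  have r18 [simp]: "Z [A,P,A,P,M] = - 1/2 * Z [A,P,M,A,M] - 1/2 * Z [A,P,A,A,M] - 1/2 * Z [A,A,A,P,M] + 1/2 * zeta 2 * zeta 3 - 15/8 * zeta 4 * ln 2"
    by ((simp (no_asm))?, (use Z_stuffle[of "[2]" "[2,-1]", simplified] in linarith))
  have r19 [simp]: "Z [M,A,P,A,M] = - 1/2 * Z [A,M,P,A,M] - 1/2 * Z [M,A,A,A,M] - 1/2 * Z [A,A,P,A,M] - 5/32 * zeta 2 * zeta 3 + 5/8 * zeta 4 * ln 2"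
    by ((simp (no_asm))?, (use Z_stuffle[of "[-2]" "[-1,-2]", simplified] in linarith))
  have r20 [simp]: "Z [A,A,M,M,P] = - Z [A,P,A,M,M] - Z [A,A,P,M,M] - Z [A,A,M,P,M] + 2 * Z [A,A,M,M,M] + Z [A,A,M,A,M] + Z [A,A,A,M,M]"
    by ((simp (no_asm))?, (use Z_regularised[of "-3" "[1]", simplified] in linarith))
  have r21 [simp]: "Z [A,M,A,M,P] = - Z [A,P,M,A,M] - Z [A,M,P,A,M] - Z [A,M,A,P,M] + Z [A,M,M,A,M] + Z [A,M,A,M,M] + Z [A,M,A,A,M] + Z [A,A,M,A,M]"
    by ((simp (no_asm))?, (use Z_regularised[of "-2" "[2]", simplified] in linarith))
  have r22 [simp]: "Z [A,A,M,M,M] = - 1/2 * Z [A,M,A,M,M] - 1/6 * Z [A,M,M,A,M] - 1/96 * zeta 2 * zeta 3"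
    by ((simp (no_asm))?, (use Z_shuffle[of "[A,M]" "[A,M,M]", simplified] in linarith))
  have r23 [simp]: "Z [A,A,A,P,M] = - Z [M,A,A,A,M] + 15/16 * zeta 5 - zeta 4 * ln 2"
    by ((simp (no_asm))?, (use Z_stuffle[of "[-1]" "[4]", simplified] in linarith))
  have r24 [simp]: "Z [M,P,A,M,M] = - Z [M,A,P,M,M] - Z [M,A,M,P,M] - Z [M,A,M,M,P] + Z [M,M,A,M,M] + 2 * Z [M,A,M,M,M] + Z [M,A,M,A,M] + Z [M,A,A,M,M] + Z [A,M,A,M,M]"
    by ((simp (no_asm))?, (use Z_regularised[of "-1" "[2,1]", simplified] in linarith))
  have r25 [simp]: "Z [M,A,A,M,M] = - Z [M,M,A,A,M] - 1/2 * Z [M,A,M,A,M] + 5/32 * zeta 4 * ln 2 - 3/8 * zeta 3 * ln 2 ^ 2"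
    by ((simp (no_asm))?, (use Z_shuffle[of "[M]" "[M,A,A,M]", simplified] in linarith))
  have r26 [simp]: "Z [M,M,A,A,M] = Z [M,P,M,A,M] + Z [M,M,P,A,M] + Z [M,M,A,P,M] + Z [M,M,A,M,P] - 2 * Z [M,M,M,A,M] - Z [M,M,A,M,M] - Z [M,A,M,A,M] - Z [A,M,M,A,M]"
    by ((simp (no_asm))?, (use Z_regularised[of "-1" "[1,2]", simplified] in linarith))
  have r27 [simp]: "Z [A,P,A,A,M] = - Z [A,A,P,A,M] - zeta 5 + 1/8 * zeta 2 * zeta 3"
    by ((simp (no_asm))?, (use Z_shuffle[of "[A,M]" "[A,A,P]", simplified] in linarith))
  have r28 [simp]: "Z [A,A,P,A,M] = - Z [A,M,A,A,M] + 15/16 * zeta 5 - 1/2 * zeta 2 * zeta 3"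
    by ((simp (no_asm))?, (use Z_stuffle[of "[-2]" "[3]", simplified] in linarith))
  have r29 [simp]: "Z [M,P,A,P,M] = - 3 * Z [M,P,M,A,M] - Z [M,P,A,A,M] - Z [M,A,M,A,M] - Z [A,P,M,A,M] - polylog 4 (1/2) * ln 2 + 19/16 * zeta 4 * ln 2 - 1/4 * zeta 3 * ln 2 ^ 2 - 1/4 * zeta 2 * ln 2 ^ 3 - 1/24 * ln 2 ^ 5"
    by ((simp (no_asm))?, (use Z_stuffle[of "[-1]" "[-1,-1,2]", simplified] in linarith))
  have [simp]: "Z [A,A,A,M,M] = - 29/32 * zeta 5 + 1/2 * zeta 2 * zeta 3"
    by ((simp (no_asm))?, (use Z_regularised[of "-4" "[]", simplified] in linarith))
  have r31 [simp]: "Z [M,M,M,A,M] = - 2/3 * Z [M,M,A,M,M] - polylog 4 (1/2) * ln 2 + zeta 4 * ln 2 - 23/24 * zeta 3 * ln 2 ^ 2 + 1/3 * zeta 2 * ln 2 ^ 3 - 1/24 * ln 2 ^ 5"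
    by ((simp (no_asm))?, (use Z_shuffle[of "[M]" "[M,M,A,M]", simplified] in linarith))
  have r32 [simp]: "Z [M,A,M,M,P] = - 3 * Z [A,M,M,M,P] - Z [A,M,M,P,M] - 2 * polylog 4 (1/2) * ln 2 + 9/8 * zeta 4 * ln 2 - 1/4 * zeta 2 * ln 2 ^ 3 - 1/12 * ln 2 ^ 5"
    by ((simp (no_asm))?, (use Z_shuffle[of "[M]" "[A,M,M,P]", simplified] in linarith))
  have r33 [simp]: "Z [A,A,P,M,M] = - 1/4 * Z [A,M,A,P,M] - 1/2 * Z [A,A,M,P,M] - 1/2 * Z [A,P,A,M,M] - 1/4 * Z [A,P,M,A,M] - 1/8 * zeta 2 * zeta 3 + 15/32 * zeta 4 * ln 2"
    by ((simp (no_asm))?, (use Z_shuffle[of "[A,M]" "[A,P,M]", simplified] in linarith))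
  have r34 [simp]: "Z [A,M,A,P,M] = - 1/2 * Z [A,M,P,A,M] - 1/2 * Z [A,M,A,A,M] + 1/2 * Z [M,A,A,A,M] - 15/32 * zeta 5 + 13/32 * zeta 2 * zeta 3 - 7/16 * zeta 4 * ln 2"
    by ((simp (no_asm))?, (use Z_stuffle[of "[-2]" "[-2,-1]", simplified] in linarith))
  have r35 [simp]: "Z [A,A,M,A,M] = - 1/3 * Z [A,M,A,A,M] + 29/16 * zeta 5 - 7/8 * zeta 2 * zeta 3"
    by ((simp (no_asm))?, (use Z_shuffle[of "[A,M]" "[A,A,M]", simplified] in linarith))
  have [simp]: "Z [A,M,A,A,M] = 51/32 * zeta 5 - 3/4 * zeta 2 * zeta 3"
    by ((simp (no_asm))?, (use Z_stuffle[of "[2]" "[-3]", simplified] in linarith))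
  have [simp]: "Z [M,A,A,A,M] = - 17/16 * zeta 5 + 3/8 * zeta 2 * zeta 3 + 7/8 * zeta 4 * ln 2"
    by ((simp (no_asm))?, (use Z_shuffle[of "[M]" "[A,A,A,M]", simplified] in linarith))
  have r38 [simp]: "Z [A,P,M,A,M] = - 2 * Z [M,A,M,A,M] - 7/32 * zeta 5 + 3/8 * zeta 4 * ln 2"
    by ((simp (no_asm))?, (use Z_stuffle[of "[2]" "[-1,2]", simplified] in linarith))
  have r39 [simp]: "Z [A,P,A,M,M] = - Z [A,M,A,M,M] - Z [A,M,M,A,M] - 11/16 * zeta 5 + 3/8 * zeta 2 * zeta 3"
    by ((simp (no_asm))?, (use Z_stuffle[of "[2]" "[-2,1]", simplified] in linarith))
  have r40 [simp]: "Z [A,M,P,A,M] = 8/3 * Z [A,M,M,A,M] + 2 * Z [M,A,M,A,M] + 283/32 * zeta 5 - 211/48 * zeta 2 * zeta 3 - 3/8 * zeta 4 * ln 2"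
    by ((simp (no_asm))?, (use Z_shuffle[of "[A,M]" "[A,M,P]", simplified] in linarith))
  have r41 [simp]: "Z [M,M,A,M,M] = - 3 * Z [A,M,A,M,M] - 5 * Z [A,M,M,A,M] - 3 * Z [M,A,M,A,M] - 3 * Z [M,A,M,M,M] - 6 * polylog 5 (1/2) + 6 * polylog 4 (1/2) * ln 2 + 3/16 * zeta 5 + 49/16 * zeta 2 * zeta 3 - 195/16 * zeta 4 * ln 2 + 127/16 * zeta 3 * ln 2 ^ 2 - 2 * zeta 2 * ln 2 ^ 3 + 3/10 * ln 2 ^ 5"
    by ((simp (no_asm))?, (use polylog_half[of 5, simplified] in linarith))
  have r42 [simp]: "Z [A,M,M,M,P] = - 1/3 * Z [A,M,M,P,M] + 1/3 * Z [M,A,M,P,M] + 1/3 * Z [M,M,A,M,P] + 1/3 * Z [M,M,A,P,M] + 1/3 * Z [M,M,P,A,M] - 4/3 * polylog 4 (1/2) * ln 2 + 1/48 * zeta 2 * zeta 3 + 3/4 * zeta 4 * ln 2 - 7/36 * zeta 2 * ln 2 ^ 3 - 1/18 * ln 2 ^ 5"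
    by ((simp (no_asm))?, (use Z_shuffle[of "[A,M]" "[M,M,P]", simplified] in linarith))
  have r43 [simp]: "Z [M,A,M,P,M] = Z [M,P,M,A,M] + 4 * polylog 4 (1/2) * ln 2 - 1/4 * zeta 2 * zeta 3 - 13/8 * zeta 4 * ln 2 + 1/8 * zeta 3 * ln 2 ^ 2 + 5/12 * zeta 2 * ln 2 ^ 3 + 1/6 * ln 2 ^ 5"
    by ((simp (no_asm))?, (use Z_shuffle[of "[M,P]" "[M,A,M]", simplified] in linarith))
  have r44 [simp]: "Z [M,P,M,A,M] = - Z [M,A,M,A,M] - 2 * Z [A,M,A,M,M] - 14/3 * Z [A,M,M,A,M] - 8 * polylog 5 (1/2) + 1/4 * zeta 5 + 49/12 * zeta 2 * zeta 3 - 131/16 * zeta 4 * ln 2 + 27/8 * zeta 3 * ln 2 ^ 2 - 7/12 * zeta 2 * ln 2 ^ 3 + 1/15 * ln 2 ^ 5"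
    by ((simp (no_asm))?, (use Z_shuffle[of "[M,P]" "[A,M,M]", simplified] in linarith))
  have r45 [simp]: "Z [A,M,A,M,M] = - 1/2 * Z [M,A,M,A,M] - Z [A,M,M,A,M] + 2 * polylog 4 (1/2) * ln 2 - 65/32 * zeta 4 * ln 2 + 7/4 * zeta 3 * ln 2 ^ 2 - 1/2 * zeta 2 * ln 2 ^ 3 + 1/12 * ln 2 ^ 5"
    by ((simp (no_asm))?, (use Z_shuffle[of "[M]" "[A,M,A,M]", simplified] in linarith))
  have r46 [simp]: "Z [M,A,M,A,M] = - 3 * Z [A,M,M,A,M] - 8 * polylog 5 (1/2) - 4 * polylog 4 (1/2) * ln 2 - 31/64 * zeta 5 + 71/16 * zeta 2 * zeta 3 - 65/16 * zeta 4 * ln 2 + 1/3 * zeta 2 * ln 2 ^ 3 - 1/10 * ln 2 ^ 5"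
    by ((simp (no_asm))?, (use Z_stuffle[of "[-1,-1]" "[-1,2]", simplified] in linarith))
  \<comment> \<open>The last pivot: after all substitutions this is the only word left in the
    relation, so its value is explicit and back substitution can start.\<close>
  have [simp]: "Z [A,M,M,A,M] = - 177/64 * zeta 5 + 23/16 * zeta 2 * zeta 3"
    by ((simp (no_asm))?, (use Z_shuffle[of "[M]" "[A,P,A,M]", simplified] in linarith))
  \<comment> \<open>Back substitution; using the equations above as a rewrite system would blow up.\<close>
  note [simp del] = r1 r2 r3 r4 r5 r6 r8 r9 r10 r11 r12 r13 r14 r15 r16 r18 r19 r20 r21 r22 r23 r24 r25 r26 r27 r28 r29 r31 r32 r33 r34 r35 r38 r39 r40 r41 r42 r43 r44 r45 r46
  have [simp]: "Z [M,A,M,A,M] = - 8 * polylog 5 (1/2) - 4 * polylog 4 (1/2) * ln 2 + 125/16 * zeta 5 + 1/8 * zeta 2 * zeta 3 - 65/16 * zeta 4 * ln 2 + 1/3 * zeta 2 * ln 2 ^ 3 - 1/10 * ln 2 ^ 5"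
    by (simp add: r46; linarith)
  have [simp]: "Z [A,M,A,M,M] = 4 * polylog 5 (1/2) + 4 * polylog 4 (1/2) * ln 2 - 73/64 * zeta 5 - 3/2 * zeta 2 * zeta 3 + 7/4 * zeta 3 * ln 2 ^ 2 - 2/3 * zeta 2 * ln 2 ^ 3 + 2/15 * ln 2 ^ 5"
    by (simp add: r45; linarith)
  have [simp]: "Z [M,P,M,A,M] = - 8 * polylog 5 (1/2) - 4 * polylog 4 (1/2) * ln 2 + 61/8 * zeta 5 + 1/4 * zeta 2 * zeta 3 - 33/8 * zeta 4 * ln 2 - 1/8 * zeta 3 * ln 2 ^ 2 + 5/12 * zeta 2 * ln 2 ^ 3 - 1/10 * ln 2 ^ 5"
    by (simp add: r44; linarith)
  have [simp]: "Z [M,M,A,M,M] = - 3 * Z [M,A,M,M,M] + 6 * polylog 5 (1/2) + 6 * polylog 4 (1/2) * ln 2 - 6 * zeta 5 + 43/16 * zeta 3 * ln 2 ^ 2 - zeta 2 * ln 2 ^ 3 + 1/5 * ln 2 ^ 5"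
    by (simp add: r41; linarith)
  have [simp]: "Z [A,M,P,A,M] = - 16 * polylog 5 (1/2) - 8 * polylog 4 (1/2) * ln 2 + 547/32 * zeta 5 - 5/16 * zeta 2 * zeta 3 - 17/2 * zeta 4 * ln 2 + 2/3 * zeta 2 * ln 2 ^ 3 - 1/5 * ln 2 ^ 5"
    by (simp add: r40; linarith)
  have [simp]: "Z [A,P,A,M,M] = - 4 * polylog 5 (1/2) - 4 * polylog 4 (1/2) * ln 2 + 103/32 * zeta 5 + 7/16 * zeta 2 * zeta 3 - 7/4 * zeta 3 * ln 2 ^ 2 + 2/3 * zeta 2 * ln 2 ^ 3 - 2/15 * ln 2 ^ 5"
    by (simp add: r39; linarith)
  have [simp]: "Z [A,P,M,A,M] = 16 * polylog 5 (1/2) + 8 * polylog 4 (1/2) * ln 2 - 507/32 * zeta 5 - 1/4 * zeta 2 * zeta 3 + 17/2 * zeta 4 * ln 2 - 2/3 * zeta 2 * ln 2 ^ 3 + 1/5 * ln 2 ^ 5"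
    by (simp add: r38; linarith)
  have [simp]: "Z [A,A,M,A,M] = 41/32 * zeta 5 - 5/8 * zeta 2 * zeta 3"
    by (simp add: r35; linarith)
  have [simp]: "Z [A,M,A,P,M] = 8 * polylog 5 (1/2) + 4 * polylog 4 (1/2) * ln 2 - 331/32 * zeta 5 + 9/8 * zeta 2 * zeta 3 + 17/4 * zeta 4 * ln 2 - 1/3 * zeta 2 * ln 2 ^ 3 + 1/10 * ln 2 ^ 5"
    by (simp add: r34; linarith)
  have [simp]: "Z [A,A,P,M,M] = - 1/2 * Z [A,A,M,P,M] - 4 * polylog 5 (1/2) - polylog 4 (1/2) * ln 2 + 79/16 * zeta 5 - 9/16 * zeta 2 * zeta 3 - 87/32 * zeta 4 * ln 2 + 7/8 * zeta 3 * ln 2 ^ 2 - 1/12 * zeta 2 * ln 2 ^ 3 - 1/120 * ln 2 ^ 5"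
    by (simp add: r33; linarith)
  have [simp]: "Z [M,M,M,A,M] = 2 * Z [M,A,M,M,M] - 4 * polylog 5 (1/2) - 5 * polylog 4 (1/2) * ln 2 + 4 * zeta 5 + zeta 4 * ln 2 - 11/4 * zeta 3 * ln 2 ^ 2 + zeta 2 * ln 2 ^ 3 - 7/40 * ln 2 ^ 5"
    by (simp add: r31; linarith)
  have [simp]: "Z [A,A,P,A,M] = - 21/32 * zeta 5 + 1/4 * zeta 2 * zeta 3"
    by (simp add: r28; linarith)
  have [simp]: "Z [A,P,A,A,M] = - 11/32 * zeta 5 - 1/8 * zeta 2 * zeta 3"
    by (simp add: r27; linarith)
  have [simp]: "Z [M,M,A,A,M] = Z [M,M,P,A,M] + Z [M,M,A,P,M] + Z [M,M,A,M,P] - Z [M,A,M,M,M] + 2 * polylog 5 (1/2) + 4 * polylog 4 (1/2) * ln 2 + 37/64 * zeta 5 - 21/16 * zeta 2 * zeta 3 - 33/16 * zeta 4 * ln 2 + 43/16 * zeta 3 * ln 2 ^ 2 - 11/12 * zeta 2 * ln 2 ^ 3 + 3/20 * ln 2 ^ 5"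
    by (simp add: r26; linarith)
  have [simp]: "Z [M,A,A,M,M] = - Z [M,M,P,A,M] - Z [M,M,A,P,M] - Z [M,M,A,M,P] + Z [M,A,M,M,M] + 2 * polylog 5 (1/2) - 2 * polylog 4 (1/2) * ln 2 - 287/64 * zeta 5 + 5/4 * zeta 2 * zeta 3 + 17/4 * zeta 4 * ln 2 - 49/16 * zeta 3 * ln 2 ^ 2 + 3/4 * zeta 2 * ln 2 ^ 3 - 1/10 * ln 2 ^ 5"
    by (simp add: r25; linarith)
  have [simp]: "Z [A,A,A,P,M] = 2 * zeta 5 - 3/8 * zeta 2 * zeta 3 - 15/8 * zeta 4 * ln 2"
    by (simp add: r23; linarith)
  have [simp]: "Z [A,A,M,M,M] = - 2 * polylog 5 (1/2) - 2 * polylog 4 (1/2) * ln 2 + 33/32 * zeta 5 + 1/2 * zeta 2 * zeta 3 - 7/8 * zeta 3 * ln 2 ^ 2 + 1/3 * zeta 2 * ln 2 ^ 3 - 1/15 * ln 2 ^ 5"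
    by (simp add: r22; linarith)
  have [simp]: "Z [A,M,A,M,P] = - 4 * polylog 5 (1/2) + 129/16 * zeta 5 - 2 * zeta 2 * zeta 3 - 17/4 * zeta 4 * ln 2 + 7/4 * zeta 3 * ln 2 ^ 2 - 1/3 * zeta 2 * ln 2 ^ 3 + 1/30 * ln 2 ^ 5"
    by (simp add: r21; linarith)
  have [simp]: "Z [A,A,M,M,P] = - 1/2 * Z [A,A,M,P,M] + 4 * polylog 5 (1/2) + polylog 4 (1/2) * ln 2 - 183/32 * zeta 5 + zeta 2 * zeta 3 + 87/32 * zeta 4 * ln 2 - 7/8 * zeta 3 * ln 2 ^ 2 + 1/12 * zeta 2 * ln 2 ^ 3 + 1/120 * ln 2 ^ 5"
    by (simp add: r20; linarith)
  have [simp]: "Z [M,A,P,A,M] = 8 * polylog 5 (1/2) + 4 * polylog 4 (1/2) * ln 2 - 123/16 * zeta 5 - 5/16 * zeta 2 * zeta 3 + 71/16 * zeta 4 * ln 2 - 1/3 * zeta 2 * ln 2 ^ 3 + 1/10 * ln 2 ^ 5"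
    by (simp add: r19; linarith)
  have [simp]: "Z [A,P,A,P,M] = - 8 * polylog 5 (1/2) - 4 * polylog 4 (1/2) * ln 2 + 227/32 * zeta 5 + 7/8 * zeta 2 * zeta 3 - 83/16 * zeta 4 * ln 2 + 1/3 * zeta 2 * ln 2 ^ 3 - 1/10 * ln 2 ^ 5"
    by (simp add: r18; linarith)
  have [simp]: "Z [A,A,A,M,P] = - 91/32 * zeta 5 + 3/4 * zeta 2 * zeta 3 + 15/8 * zeta 4 * ln 2"
    by (simp add: r16; linarith)
  have [simp]: "Z [A,A,M,A,P] = 67/16 * zeta 5 - 9/4 * zeta 2 * zeta 3"
    by (simp add: r15; linarith)
  have [simp]: "Z [A,M,A,A,P] = - 83/16 * zeta 5 + 21/8 * zeta 2 * zeta 3"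
    by (simp add: r12; linarith)
  have [simp]: "Z [A,M,M,M,M] = - polylog 5 (1/2) - polylog 4 (1/2) * ln 2 + zeta 5 - 7/16 * zeta 3 * ln 2 ^ 2 + 1/6 * zeta 2 * ln 2 ^ 3 - 1/30 * ln 2 ^ 5"
    by (simp add: r11; linarith)
  have [simp]: "Z [A,A,A,A,P] = zeta 5"
    by (simp add: r10; linarith)
  have [simp]: "Z [A,A,A,P,P] = 2 * zeta 5 - zeta 2 * zeta 3"
    by (simp add: r9; linarith)
  have [simp]: "Z [A,P,P,A,M] = - 53/64 * zeta 5 + 3/16 * zeta 2 * zeta 3"
    by (simp add: r6; linarith)
  have [simp]: "Z [A,P,A,M,P] = 4 * polylog 5 (1/2) - 259/64 * zeta 5 - 1/2 * zeta 2 * zeta 3 + 83/16 * zeta 4 * ln 2 - 7/4 * zeta 3 * ln 2 ^ 2 + 1/3 * zeta 2 * ln 2 ^ 3 - 1/30 * ln 2 ^ 5"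
    by (simp add: r5; linarith)
  have [simp]: "Z [A,M,P,A,P] = 257/64 * zeta 5 - 5/2 * zeta 2 * zeta 3 + 15/16 * zeta 4 * ln 2"
    by (simp add: r4; linarith)
  have [simp]: "Z [A,M,M,A,P] = 5/8 * zeta 5 - 5/16 * zeta 2 * zeta 3"
    by (simp add: r3; linarith)
  have [simp]: "Z [M,A,M,A,P] = - Z [M,A,P,A,P] - Z [M,A,A,A,P] - Z [A,A,P,A,P] - 257/64 * zeta 5 + 21/8 * zeta 2 * zeta 3 - 25/16 * zeta 4 * ln 2"
    by (simp add: r2; linarith)
  have [simp]: "Z [A,M,A,P,P] = 41/32 * zeta 5 - 11/16 * zeta 2 * zeta 3"
    by (simp add: r1; linarith)
  show "euler_value (-2) [1,-2] =
    125/32 * zeta 5 - 13/8 * zeta 2 * zeta 3"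
    "euler_value (-1) [2,-2] =
    75/64 * zeta 5 + 3/8 * zeta 2 * zeta 3 - 25/16 * zeta 4 * ln 2"
    "euler_value 2 [1,-2] =
    - 4 * polylog 5 (1/2) - 4 * polylog 4 (1/2) * ln 2 - 29/64 * zeta 5 + 5/4 * zeta 2 * zeta 3 - 7/4 * zeta 3 * ln 2 ^ 2 + 2/3 * zeta 2 * ln 2 ^ 3 - 2/15 * ln 2 ^ 5"
    "euler_value (-1) [1,1,2] =
    2 * polylog 4 (1/2) * ln 2 - 3/8 * zeta 2 * zeta 3 - 7/8 * zeta 4 * ln 2 + 7/8 * zeta 3 * ln 2 ^ 2 - 1/3 * zeta 2 * ln 2 ^ 3 + 1/12 * ln 2 ^ 5"
    "euler_value 2 [2,-1] =
    8 * polylog 5 (1/2) + 4 * polylog 4 (1/2) * ln 2 - 27/4 * zeta 5 - 1/2 * zeta 2 * zeta 3 + 23/16 * zeta 4 * ln 2 - 1/3 * zeta 2 * ln 2 ^ 3 + 1/10 * ln 2 ^ 5"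
    "euler_value (-1) [2,2] =
    - 16 * polylog 5 (1/2) - 8 * polylog 4 (1/2) * ln 2 + 259/16 * zeta 5 - 5/8 * zeta 2 * zeta 3 - 29/4 * zeta 4 * ln 2 + 2/3 * zeta 2 * ln 2 ^ 3 - 1/5 * ln 2 ^ 5"
    "euler_value (-1) [-2,-2] =
    16 * polylog 5 (1/2) + 8 * polylog 4 (1/2) * ln 2 - 299/16 * zeta 5 + 1/4 * zeta 2 * zeta 3 + 39/4 * zeta 4 * ln 2 - 2/3 * zeta 2 * ln 2 ^ 3 + 1/5 * ln 2 ^ 5"
    "euler_value (-1) [1,1,1,1] =
    - 8 * polylog 5 (1/2) - 4 * polylog 4 (1/2) * ln 2 + 83/16 * zeta 5 + 11/8 * zeta 2 * zeta 3 - 11/4 * zeta 4 * ln 2 - 9/4 * zeta 3 * ln 2 ^ 2 + 4/3 * zeta 2 * ln 2 ^ 3 - 3/10 * ln 2 ^ 5"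
    by (simp add: euler_value_def; linarith)+
qed

end

theorem mainTheorem2:
  shows
    "((\<lambda>N. \<Sum>n=1..N. harm n * alt_harm 2 n / real n ^ 2 * (-1) ^ (n - 1)) \<longlonglongrightarrow>
        125/32 * zeta 5 - 13/8 * zeta 2 * zeta 3)
   \<and> ((\<lambda>N. \<Sum>n=1..N. gen_harm 2 n * alt_harm 2 n / real n * (-1) ^ (n - 1)) \<longlonglongrightarrow>
        75/64 * zeta 5 + 3/8 * zeta 2 * zeta 3 - 25/16 * zeta 4 * ln 2)
   \<and> ((\<lambda>N. \<Sum>n=1..N. harm n * alt_harm 2 n / real n ^ 2) \<longlonglongrightarrow>
        4 * polylog 5 (1/2) + 4 * polylog 4 (1/2) * ln 2 + 2/15 * ln 2 ^ 5 + 29/64 * zeta 5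
        + 7/4 * zeta 3 * ln 2 ^ 2 - 2/3 * zeta 2 * ln 2 ^ 3 - 5/4 * zeta 2 * zeta 3)
   \<and> ((\<lambda>N. \<Sum>n=1..N. harm n ^ 2 * gen_harm 2 n / real n * (-1) ^ (n - 1)) \<longlonglongrightarrow>
        - 2 * polylog 4 (1/2) * ln 2 - 1/12 * ln 2 ^ 5 - 7/8 * zeta 3 * ln 2 ^ 2
        + 1/3 * zeta 2 * ln 2 ^ 3 + 3/8 * zeta 2 * zeta 3 + 7/8 * zeta 4 * ln 2)
   \<and> ((\<lambda>N. \<Sum>n=1..N. gen_harm 2 n * alt_harm 1 n / real n ^ 2) \<longlonglongrightarrow>
        - 8 * polylog 5 (1/2) - 4 * polylog 4 (1/2) * ln 2 - 1/10 * ln 2 ^ 5 + 27/4 * zeta 5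
        + 1/3 * zeta 2 * ln 2 ^ 3 + 1/2 * zeta 2 * zeta 3 - 23/16 * zeta 4 * ln 2)
   \<and> ((\<lambda>N. \<Sum>n=1..N. gen_harm 2 n ^ 2 / real n * (-1) ^ (n - 1)) \<longlonglongrightarrow>
        16 * polylog 5 (1/2) + 8 * polylog 4 (1/2) * ln 2 + 1/5 * ln 2 ^ 5 - 259/16 * zeta 5
        - 2/3 * zeta 2 * ln 2 ^ 3 + 5/8 * zeta 2 * zeta 3 + 29/4 * zeta 4 * ln 2)
   \<and> ((\<lambda>N. \<Sum>n=1..N. alt_harm 2 n ^ 2 / real n * (-1) ^ (n - 1)) \<longlonglongrightarrow>
        - 16 * polylog 5 (1/2) - 8 * polylog 4 (1/2) * ln 2 - 1/5 * ln 2 ^ 5 + 299/16 * zeta 5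
        + 2/3 * zeta 2 * ln 2 ^ 3 - 1/4 * zeta 2 * zeta 3 - 39/4 * zeta 4 * ln 2)
   \<and> ((\<lambda>N. \<Sum>n=1..N. harm n ^ 4 / real n * (-1) ^ (n - 1)) \<longlonglongrightarrow>
        8 * polylog 5 (1/2) + 4 * polylog 4 (1/2) * ln 2 + 3/10 * ln 2 ^ 5
        + 9/4 * zeta 3 * ln 2 ^ 2 - 83/16 * zeta 5 - 4/3 * zeta 2 * ln 2 ^ 3
        - 11/8 * zeta 2 * zeta 3 + 11/4 * zeta 4 * ln 2)"
proof -
  \<comment> \<open>Fails for n = 0, where the truncated exponent n - 1 is 0; the sums start at
    1.\<close>
  have sign: "(-1 :: real) ^ (n - Suc 0) = - ((-1) ^ n)" if "n \<ge> Suc 0" for n :: nat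
    using that by (cases n) auto
  note conv = gen_harm_conv_S alt_harm_conv_S S_1[symmetric] sign sg_def power2_eq_square power4_eq_xxxx
  \<comment> \<open>Here and below the factor in the limit is -1 to the number of alternating
    ingredients, counting the weight and each alternating harmonic number.\<close>
  have a: "(\<lambda>N. \<Sum>n=1..N. harm n * alt_harm 2 n / real n ^ 2 * (-1) ^ (n - 1)) \<longlonglongrightarrow> 1 * euler_value (-2) [1,-2]"
    by (rule euler_sum_tendsto) (simp_all add: conv del: S.simps)
  have b: "(\<lambda>N. \<Sum>n=1..N. gen_harm 2 n * alt_harm 2 n / real n * (-1) ^ (n - 1)) \<longlonglongrightarrow> 1 * euler_value (-1) [2,-2]"
    by (rule euler_sum_tendsto) (simp_all add: conv del: S.simps)
  have c: "(\<lambda>N. \<Sum>n=1..N. harm n * alt_harm 2 n / real n ^ 2) \<longlonglongrightarrow> (-1) * euler_value 2 [1,-2]"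
    by (rule euler_sum_tendsto) (simp_all add: conv del: S.simps)
  have d: "(\<lambda>N. \<Sum>n=1..N. harm n ^ 2 * gen_harm 2 n / real n * (-1) ^ (n - 1)) \<longlonglongrightarrow> (-1) * euler_value (-1) [1,1,2]"
    by (rule euler_sum_tendsto) (simp_all add: conv del: S.simps)
  have e: "(\<lambda>N. \<Sum>n=1..N. gen_harm 2 n * alt_harm 1 n / real n ^ 2) \<longlonglongrightarrow> (-1) * euler_value 2 [2,-1]"
    by (rule euler_sum_tendsto) (simp_all add: conv del: S.simps)
  have f: "(\<lambda>N. \<Sum>n=1..N. gen_harm 2 n ^ 2 / real n * (-1) ^ (n - 1)) \<longlonglongrightarrow> (-1) * euler_value (-1) [2,2]"
    by (rule euler_sum_tendsto) (simp_all add: conv del: S.simps)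
  have g: "(\<lambda>N. \<Sum>n=1..N. alt_harm 2 n ^ 2 / real n * (-1) ^ (n - 1)) \<longlonglongrightarrow> (-1) * euler_value (-1) [-2,-2]"
    by (rule euler_sum_tendsto) (simp_all add: conv del: S.simps)
  have h: "(\<lambda>N. \<Sum>n=1..N. harm n ^ 4 / real n * (-1) ^ (n - 1)) \<longlonglongrightarrow> (-1) * euler_value (-1) [1,1,1,1]"
    by (rule euler_sum_tendsto) (simp_all add: conv del: S.simps)
  show ?thesis
    using a b c d e f g h unfolding weight_5_values by (simp add: algebra_simps)
qed

end
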